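(* Let $q$ be an odd prime power, and let $\mathcal C,\mathcal D\subset\mathbb P^2$ be two smooth plane conics defined over $\mathbb F_q$, represented by symmetric $3\times 3$ matrices $C$ and $D$ over $\mathbb F_q$. Assume that $\mathcal C$ and $\mathcal D$ intersect transversely. Let $E_1: y^2=\det(D)\det(xC+D)$ be the elliptic curve over $\mathbb F_q$ associated to the pair $(\mathcal C,\mathcal D)$, and let $t_1$ be its Frobenius trace. Let $b_1$ be the number of $\mathbb F_q$-rational intersection points of $\mathcal C$ and $\mathcal D$. Then \begin{align*} |\{P\in \mathcal C(\mathbb F_q)\setminus \mathcal D : P \text{ is external to } \mathcal D \}| &= \frac12(q+1-t_1-b_1),\\ |\{P\in \mathcal C(\mathbb F_q)\setminus \mathcal D : P \text{ is internal to } \mathcal D \}| &= \frac12(q+1+t_1-b_1). \end{align*}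
   Context: A conic $\mathcal C$ is represented by a symmetric $3\times3$ matrix $C$ over $\mathbb F_q$ if $\mathcal C=\{[v]\in\mathbb P^2 : v^{T}Cv=0\}$; it is smooth iff $\det C\neq 0$. Two conics intersect transversely if they meet transversely over $\overline{\mathbb F_q}$, i.e. in four distinct points of $\mathbb P^2(\overline{\mathbb F_q})$. Let $P\in\mathbb P^2(\mathbb F_q)\setminus\mathcal D$. Over $\overline{\mathbb F_q}$ there are exactly two distinct tangent lines of $\mathcal D$ through $P$. The point $P$ is called external to $\mathcal D$ if these two tangent lines are defined over $\mathbb F_q$, and internal to $\mathcal D$ if they are Galois-conjugate lines defined over $\mathbb F_{q^2}$ but not over $\mathbb F_q$. The elliptic curve given by an affine equation $y^2=g(x)$ with $g$ a separable cubic means the smooth projective model (one point at infinity). The Frobenius trace of an elliptic curve $E$ over $\mathbb F_q$ is $t=q+1-|E(\mathbb F_q)|$. *)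

theory Defs
  imports "HOL-Analysis.Determinants" "HOL-Algebra.Algebraic_Closure_Type"
begin

section \<open>Points and lines of the projective plane\<close>

text \<open>
  A point \<open>[v]\<close> of \<open>P\<^sup>2(K)\<close>, where \<open>v \<noteq> 0\<close>, is the one-dimensional subspace of \<open>K\<^sup>3\<close> spanned by
  \<open>v\<close>. A line is the set of points on it.
\<close>

type_synonym 'k ppoint = "('k ^ 3) set"

definition proj_point :: "'k::field ^ 3 \<Rightarrow> 'k ppoint" where
  "proj_point v = {c *s v | c. True}"

definition proj_line :: "'k::field ^ 3 \<Rightarrow> 'k ppoint set" where
  "proj_line a = {proj_point v | v. v \<noteq> 0 \<and> scalar_product a v = 0}"

text \<open>Base change to the algebraic closure, for coordinate vectors, matrices and points.\<close>

definition vec_ac :: "'a::field ^ 3 \<Rightarrow> 'a alg_closure ^ 3" where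
  "vec_ac v = (\<chi> i. to_ac (v $ i))"

definition mat_ac :: "'a::field ^ 3 ^ 3 \<Rightarrow> 'a alg_closure ^ 3 ^ 3" where
  "mat_ac A = map_matrix to_ac A"

definition ppoint_ac :: "'a::field ppoint \<Rightarrow> 'a alg_closure ppoint" where
  "ppoint_ac P = {c *s vec_ac v | c v. v \<in> P}"

lemma ppoint_ac_proj_point: "ppoint_ac (proj_point v) = proj_point (vec_ac v)"
proof -
  have eq: "c *s vec_ac (d *s v) = (c * to_ac d) *s vec_ac v" for c d
    by (simp add: vec_ac_def vec_eq_iff mult.assoc)
  have "c *s vec_ac v = c *s vec_ac (1 *s v)" for c
    by simp
  then show ?thesis
    unfolding ppoint_ac_def proj_point_def using eq by blast
qed


section \<open>Conics\<close>

definition quad_form :: "'k::field ^ 3 ^ 3 \<Rightarrow> 'k ^ 3 \<Rightarrow> 'k" where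
  "quad_form A v = scalar_product v (A *v v)"

definition conic :: "'k::field ^ 3 ^ 3 \<Rightarrow> 'k ppoint set" where
  "conic A = {proj_point v | v. v \<noteq> 0 \<and> quad_form A v = 0}"

text \<open>The vector of partial derivatives of \<open>v\<^sup>T A v\<close>; it equals \<open>2 A v\<close> if \<open>A\<close> is symmetric.\<close>

definition conic_gradient :: "'k::field ^ 3 ^ 3 \<Rightarrow> 'k ^ 3 \<Rightarrow> 'k ^ 3" where
  "conic_gradient A v = (A + transpose A) *v v"

text \<open>Smoothness is the Jacobian criterion at all geometric points.\<close>

definition smooth_conic :: "'a::field ^ 3 ^ 3 \<Rightarrow> bool" where
  "smooth_conic A \<longleftrightarrow>
     (\<forall>v. v \<noteq> 0 \<and> quad_form (mat_ac A) v = 0 \<longrightarrow> conic_gradient (mat_ac A) v \<noteq> 0)"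

lemma det_mat_ac: "det (mat_ac A) = to_ac (det A)"
  by (simp add: mat_ac_def det_def to_ac_sum to_ac_prod)

lemma smooth_conic_iff_det:
  fixes A :: "'a::field ^ 3 ^ 3"
  assumes "transpose A = A" and "(2::'a) \<noteq> 0"
  shows "smooth_conic A \<longleftrightarrow> det A \<noteq> 0"
proof -
  have two: "(2::'a alg_closure) \<noteq> 0"
    using assms(2) by (metis to_ac_eq_0_iff to_ac_numeral)
  have sym: "transpose (mat_ac A) = mat_ac A"
    using assms(1) by (simp add: mat_ac_def transpose_def vec_eq_iff)
  have grad: "conic_gradient (mat_ac A) v = 2 *s (mat_ac A *v v)" for v
    unfolding conic_gradient_def sym matrix_vector_mult_add_rdistrib
    by (simp only: vec_eq_iff vector_add_component vector_smult_component mult_2 simp_thms)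
  have "conic_gradient (mat_ac A) v = 0 \<longleftrightarrow> mat_ac A *v v = 0" for v
    using two by (simp add: grad)
  moreover have "quad_form (mat_ac A) v = 0" if "mat_ac A *v v = 0" for v
    using that by (simp add: quad_form_def scalar_product_def)
  ultimately have "smooth_conic A \<longleftrightarrow> (\<forall>v. mat_ac A *v v = 0 \<longrightarrow> v = 0)"
    unfolding smooth_conic_def by blast
  also have "\<dots> \<longleftrightarrow> invertible (mat_ac A)"
    using matrix_left_invertible_ker[of "mat_ac A"] invertible_left_inverse[of "mat_ac A"] by blast
  finally show ?thesis
    by (simp add: invertible_det_nz det_mat_ac)
qed

definition transverse_conics :: "'a::field ^ 3 ^ 3 \<Rightarrow> 'a ^ 3 ^ 3 \<Rightarrow> bool" where
  "transverse_conics A B \<longleftrightarrow> card (conic (mat_ac A) \<inter> conic (mat_ac B)) = 4"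


section \<open>External and internal points\<close>

definition tangent_lines_through :: "'k::field ^ 3 ^ 3 \<Rightarrow> 'k ppoint \<Rightarrow> 'k ppoint set set" where
  "tangent_lines_through A P =
     {proj_line (conic_gradient A w) | w.
        w \<noteq> 0 \<and> quad_form A w = 0 \<and> P \<in> proj_line (conic_gradient A w)}"

definition line_defined_over :: "'k::field set \<Rightarrow> 'k ppoint set \<Rightarrow> bool" where
  "line_defined_over F L \<longleftrightarrow> (\<exists>a. a \<noteq> 0 \<and> (\<forall>i. a $ i \<in> F) \<and> L = proj_line a)"

text \<open>
  The subfields with \<open>q\<close> and \<open>q\<^sup>2\<close> elements of the algebraic closure of the field \<open>'a\<close> with \<open>q\<close>
  elements.
\<close>

definition Fq :: "'a::{field,finite} alg_closure set" where
  "Fq = range to_ac"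

definition Fq2 :: "'a::{field,finite} alg_closure set" where
  "Fq2 = {x. x ^ (CARD('a) ^ 2) = x}"

text \<open>Image of a line under the \<open>q\<close>-power Frobenius acting on the coordinates of its points.\<close>

definition frob_vec :: "'a::{field,finite} alg_closure ^ 3 \<Rightarrow> 'a alg_closure ^ 3" where
  "frob_vec v = (\<chi> i. (v $ i) ^ CARD('a))"

definition frob_line :: "'a::{field,finite} alg_closure ppoint set \<Rightarrow> 'a alg_closure ppoint set" where
  "frob_line L = (\<lambda>P. frob_vec ` P) ` L"

definition external_point :: "'a::{field,finite} ^ 3 ^ 3 \<Rightarrow> 'a ppoint \<Rightarrow> bool" where
  "external_point D P \<longleftrightarrow> P \<notin> conic D \<and>
     (\<exists>L1 L2. L1 \<noteq> L2 \<and> tangent_lines_through (mat_ac D) (ppoint_ac P) = {L1, L2} \<and>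
        line_defined_over Fq L1 \<and> line_defined_over Fq L2)"

definition internal_point :: "'a::{field,finite} ^ 3 ^ 3 \<Rightarrow> 'a ppoint \<Rightarrow> bool" where
  "internal_point D P \<longleftrightarrow> P \<notin> conic D \<and>
     (\<exists>L1 L2. L1 \<noteq> L2 \<and> tangent_lines_through (mat_ac D) (ppoint_ac P) = {L1, L2} \<and>
        L2 = frob_line L1 \<and>
        line_defined_over Fq2 L1 \<and> line_defined_over Fq2 L2 \<and>
        \<not> line_defined_over Fq L1 \<and> \<not> line_defined_over Fq L2)"


section \<open>The elliptic curve of a pair of conics\<close>

text \<open>
  The projective closure \<open>Y\<^sup>2 Z = Z\<^sup>3 g(X/Z)\<close> of \<open>y\<^sup>2 = g(x)\<close> for a cubic \<open>g\<close>. If \<open>g\<close> is separable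
  (and 2 is invertible), this is the smooth projective model, and \<open>[0:1:0]\<close> is its only point at
  infinity.
\<close>

definition cubic_model :: "'k::field poly \<Rightarrow> 'k ppoint set" where
  "cubic_model g = {proj_point (vector [x, y, z]) | x y z.
     (x, y, z) \<noteq> (0, 0, 0) \<and>
     y ^ 2 * z = (\<Sum>i\<le>3. Polynomial.coeff g i * x ^ i * z ^ (3 - i))}"

definition frobenius_trace :: "'a::{field,finite} poly \<Rightarrow> int" where
  "frobenius_trace g = int CARD('a) + 1 - int (card (cubic_model g))"

text \<open>The polynomial \<open>det(D) det(xC + D)\<close> in \<open>x\<close>.\<close>

definition pencil_cubic :: "'k::field ^ 3 ^ 3 \<Rightarrow> 'k ^ 3 ^ 3 \<Rightarrow> 'k poly" where
  "pencil_cubic C D = Polynomial.smult (det D) (det (\<chi> i j. [:D $ i $ j, C $ i $ j:]))"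

end

(*
  Let chi be the quadratic character of F_q. A point [v] off D is external iff chi(-det D * D(v)) = 1 and
  internal iff it is -1: in a basis that starts with v and diagonalises D to a x^2 + b y^2 + e z^2, the
  tangents through [v] touch D where x = 0 and b y^2 + e z^2 = 0, so they are rational iff -e/b, which
  agrees with -det D * D(v) up to squares, is a square. Hence, with c = -det D, the vectors v with
  C(v) = 0 and D(v) = c lie two by two above the external points of C.

  The elliptic curve enters by counting pairs (x, v) with x C(v) + D(v) = c and with x C(v) + D(v) = 0 in
  two ways. For fixed v the equation is linear in x. For fixed x, a ternary form Q of rank at
  least two satisfies (q - 1) #{Q = c} + #{Q = 0} = q^3 + q (q - 1) chi(-c det Q), also when Q is singular:
  this combination of the two counts absorbs the contributions of the singular members, so no
  isomorphism between E_1 and the Jacobian of the double cover of C is needed. Transversality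
  excludes members of rank at most one, which would cut C in a line section or in all of C.
*)
theory Submission
  imports Defs
begin

no_notation fps_nth (infixl \<open>$\<close> 75)

section \<open>The quadratic character of a finite field\<close>

text \<open>The constant c = -det D makes the two sides meet: for Q = xC + D the argument -c det Q
  becomes det(D) det(xC + D), the right-hand side of E_1, whose character sum over x is -t_1. Its
  sign is that of a binary discriminant: b y^2 + e z^2, the restriction of D to the orthogonal
  complement of v, splits iff -be is a square, while det D is a b e up to squares and D(v) = a. The
  weight q - 1 is forced by the members of rank two. If Q is a x^2 + b y^2 in suitable coordinates
  and h = chi(-ab), then Q takes each nonzero value q^2 - q h times and the value 0 at q^2 - q h +
  q^2 h vectors. Up to scale, (q - 1) #{Q = c} + #{Q = 0} is the only combination from which h
  disappears, and it equals q^3, in agreement with chi(0) = 0.\<close>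

lemma card_gt_1: "CARD('a::{field,finite}) > 1"
proof -
  have "card {0, 1::'a} \<le> CARD('a)" by (rule card_mono) auto
  then show ?thesis by simp
qed

text \<open>With this encoding y^2 = a has \<open>1 + quad_char a\<close> solutions by definition,
  so character sums are point counts. When 2 is invertible it is the usual quadratic character, and
  multiplicativity becomes a theorem.\<close>

definition quad_char :: "'a::{field,finite} \<Rightarrow> int" where
  "quad_char a = int (card {x. x\<^sup>2 = a}) - 1"

text \<open>Translation by 1 permutes the field, so the sum of all elements equals itself plus q
  times 1, and q vanishes in the field. If 2 vanished as well, an odd q would also be 1.\<close>

lemma two_neq_zero_if_odd_card:
  assumes "odd CARD('a::{field,finite})"
  shows "(2::'a) \<noteq> 0"
proof
  assume 2: "(2::'a) = 0"
  obtain k where "CARD('a) = 2 * k + 1" using assms by (rule oddE)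
  then have "of_nat CARD('a) = (1::'a)" using 2 by simp
  moreover have "of_nat CARD('a) = (0::'a)"
  proof -
    have "(\<Sum>x\<in>(UNIV::'a set). x) = (\<Sum>x\<in>UNIV. x + 1)"
      by (rule sum.reindex_bij_witness[of _ "\<lambda>x. x + 1" "\<lambda>x. x - 1"]) auto
    then show ?thesis by (simp add: sum.distrib)
  qed
  ultimately show False by simp
qed

lemma roots_of_square:
  fixes x :: "'a::field"
  shows "{y. y\<^sup>2 = x\<^sup>2} = {x, -x}"
  by (auto simp: power2_eq_iff)

lemma neg_neq_self:
  fixes x :: "'a::field"
  assumes "(2::'a) \<noteq> 0" "x \<noteq> 0"
  shows "x \<noteq> -x"
  using assms by (metis add.right_inverse mult_2 no_zero_divisors)

lemma quad_char_0 [simp]: "quad_char (0::'a::{field,finite}) = 0"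
  by (simp add: quad_char_def)

lemma quad_char_square:
  fixes x :: "'a::{field,finite}"
  assumes "(2::'a) \<noteq> 0" "x \<noteq> 0"
  shows "quad_char (x\<^sup>2) = 1"
  using neg_neq_self[OF assms] by (simp add: quad_char_def roots_of_square)

lemma quad_char_nonsquare:
  fixes a :: "'a::{field,finite}"
  assumes "\<nexists>x. x\<^sup>2 = a"
  shows "quad_char a = -1"
  using assms by (simp add: quad_char_def)

lemma quad_char_cases:
  fixes a :: "'a::{field,finite}"
  assumes "(2::'a) \<noteq> 0"
  obtains "a = 0" "quad_char a = 0"
  | x where "x \<noteq> 0" "a = x\<^sup>2" "quad_char a = 1"
  | "a \<noteq> 0" "\<nexists>x. x\<^sup>2 = a" "quad_char a = -1"
  using quad_char_square[OF assms] quad_char_nonsquare[of a] quad_char_0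
  by (metis zero_eq_power2)

lemma quad_char_mult_square:
  fixes a x :: "'a::{field,finite}"
  assumes "x \<noteq> 0"
  shows "quad_char (x\<^sup>2 * a) = quad_char a"
proof -
  have "bij_betw (\<lambda>y. x * y) {y. y\<^sup>2 = a} {y. y\<^sup>2 = x\<^sup>2 * a}"
    by (rule bij_betw_byWitness[of _ "\<lambda>y. y / x"]) (use assms in \<open>auto simp: power_mult_distrib power_divide\<close>)
  then show ?thesis by (simp add: quad_char_def bij_betw_same_card)
qed

text \<open>Every x is a square root of exactly one element, so the root counts add up to q and
  \<open>quad_char\<close> sums to 0. Its values 1 and -1 are therefore equally frequent.\<close>

lemma card_nonsquares:
  assumes "(2::'a::{field,finite}) \<noteq> 0"
  shows "card {a::'a. a \<noteq> 0 \<and> \<not> (\<exists>x. x\<^sup>2 = a)} = card {a::'a. a \<noteq> 0 \<and> (\<exists>x. x\<^sup>2 = a)}"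
proof -
  have "(\<Sum>a\<in>(UNIV::'a set). card {x. x\<^sup>2 = a}) = card (\<Union>a\<in>(UNIV::'a set). {x. x\<^sup>2 = a})"
    by (rule card_UN_disjoint[symmetric]) auto
  also have "(\<Union>a\<in>(UNIV::'a set). {x. x\<^sup>2 = a}) = UNIV" by auto
  finally have "(\<Sum>a\<in>(UNIV::'a set). quad_char a) = 0"
    by (simp add: quad_char_def sum_subtractf flip: of_nat_sum)
  moreover have "quad_char a = (if a \<noteq> 0 \<and> (\<exists>x. x\<^sup>2 = a) then 1 else 0)
      - (if a \<noteq> 0 \<and> \<not> (\<exists>x. x\<^sup>2 = a) then 1 else 0)" for a :: 'a
    by (rule quad_char_cases[OF assms, of a]) auto
  ultimately show ?thesis
    by (simp add: sum_subtractf flip: sum.inter_filter)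
qed

text \<open>The only substantial case is that of two nonsquares. Multiplication by the nonsquare
  \<open>a\<close> sends nonzero squares injectively to nonsquares; the two sets have equal size, so
  it is onto, and b = a s^2 gives a b = (a s)^2.\<close>

lemma quad_char_mult:
  fixes a b :: "'a::{field,finite}"
  assumes 2: "(2::'a) \<noteq> 0"
  shows "quad_char (a * b) = quad_char a * quad_char b"
proof (rule quad_char_cases[OF 2, of a])
  assume a: "a \<noteq> 0" "\<nexists>x. x\<^sup>2 = a" "quad_char a = -1"
  show ?thesis
  proof (rule quad_char_cases[OF 2, of b])
    assume b: "b \<noteq> 0" "\<nexists>x. x\<^sup>2 = b" "quad_char b = -1"
    let ?S = "{a::'a. a \<noteq> 0 \<and> (\<exists>x. x\<^sup>2 = a)}" and ?N = "{a::'a. a \<noteq> 0 \<and> \<not> (\<exists>x. x\<^sup>2 = a)}"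
    have "(\<lambda>s. a * s) ` ?S \<subseteq> ?N"
    proof -
      have "y\<^sup>2 \<noteq> a * x\<^sup>2" if "x \<noteq> 0" for x y
      proof
        assume "y\<^sup>2 = a * x\<^sup>2"
        then have "(y / x)\<^sup>2 = a" using that by (simp add: power_divide)
        with a show False by blast
      qed
      then show ?thesis using a by auto
    qed
    moreover have "card ((\<lambda>s. a * s) ` ?S) = card ?N"
      using a by (subst card_image) (auto simp: inj_on_def card_nonsquares[OF 2, simplified])
    ultimately have "(\<lambda>s. a * s) ` ?S = ?N"
      by (intro card_subset_eq) auto
    moreover have "b \<in> ?N" using b by auto
    ultimately have "b \<in> (\<lambda>s. a * s) ` ?S" by metis
    then obtain r where "r \<in> ?S" "b = a * r" by (rule imageE)
    then obtain s where "r = s\<^sup>2" "r \<noteq> 0" by blast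
    with \<open>b = a * r\<close> have s: "b = a * s\<^sup>2" "s \<noteq> 0" by auto
    then have "a * b = (a * s)\<^sup>2" by (simp add: power2_eq_square)
    then show ?thesis using a b s quad_char_square[OF 2, of "a * s"] by simp
  qed (use a in \<open>auto simp: quad_char_mult_square mult.commute[of a]\<close>)
qed (auto simp: quad_char_mult_square)

section \<open>Point counts for diagonal forms in two and three variables\<close>

text \<open>Up to the summand q this counts the points of the hyperbola y^2 - x^2 = k. The
  coordinate u = x + y runs through the q - 1 nonzero elements, and y - x = k / u recovers the
  point.\<close>

lemma sum_quad_char_shifted_square:
  fixes k :: "'a::{field,finite}"
  assumes 2: "(2::'a) \<noteq> 0" and k: "k \<noteq> 0"
  shows "(\<Sum>x\<in>UNIV. quad_char (x\<^sup>2 + k)) = -1"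
proof -
  have "(4::'a) = 2 * 2" by simp
  then have 4: "(4::'a) \<noteq> 0" using no_zero_divisors[OF 2 2] by argo
  have "bij_betw (\<lambda>u::'a. ((u - k / u) / 2, (u + k / u) / 2)) (UNIV - {0}) (SIGMA x:UNIV. {y. y\<^sup>2 = x\<^sup>2 + k})"
  proof (rule bij_betw_byWitness[of _ "\<lambda>(x, y). x + y"])
    show "\<forall>u\<in>UNIV - {0}. (case ((u - k / u) / 2, (u + k / u) / 2) of (x, y) \<Rightarrow> x + y) = u"
      using 2 4 by (simp add: field_simps)
    have *: "x + y \<noteq> 0 \<and> k / (x + y) = y - x" if "y\<^sup>2 = x\<^sup>2 + k" for x y
    proof -
      have e: "k = (y - x) * (x + y)" using that by (simp add: algebra_simps power2_eq_square)
      then have "x + y \<noteq> 0" using k by auto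
      then show ?thesis using e by simp
    qed
    show "\<forall>p\<in>SIGMA x:UNIV. {y. y\<^sup>2 = x\<^sup>2 + k}.
        (((case p of (x, y) \<Rightarrow> x + y) - k / (case p of (x, y) \<Rightarrow> x + y)) / 2,
         ((case p of (x, y) \<Rightarrow> x + y) + k / (case p of (x, y) \<Rightarrow> x + y)) / 2) = p"
      using 2 by (auto simp: * simp flip: mult_2_right)
    show "(\<lambda>u. ((u - k / u) / 2, (u + k / u) / 2)) ` (UNIV - {0}) \<subseteq> (SIGMA x:UNIV. {y. y\<^sup>2 = x\<^sup>2 + k})"
    proof (rule image_subsetI)
      fix u :: 'a assume u: "u \<in> UNIV - {0}"
      have "((u + k / u) / 2)\<^sup>2 - ((u - k / u) / 2)\<^sup>2 = (u * (k / u)) * (4 / 4)"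
        using 2 4 by (simp add: power_divide power2_eq_square algebra_simps flip: diff_divide_distrib add_divide_distrib)
      also have "\<dots> = k" using u 4 by simp
      finally show "((u - k / u) / 2, (u + k / u) / 2) \<in> (SIGMA x:UNIV. {y. y\<^sup>2 = x\<^sup>2 + k})"
        by (simp add: algebra_simps)
    qed
    show "(\<lambda>(x, y). x + y) ` (SIGMA x:UNIV. {y. y\<^sup>2 = x\<^sup>2 + k}) \<subseteq> UNIV - {0}"
      using * by auto
  qed
  from bij_betw_same_card[OF this]
  have "card (SIGMA x:(UNIV::'a set). {y. y\<^sup>2 = x\<^sup>2 + k}) = CARD('a) - 1"
    by simp
  then have "(\<Sum>x\<in>(UNIV::'a set). int (card {y. y\<^sup>2 = x\<^sup>2 + k})) = int CARD('a) - 1"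
    by (simp add: card_SigmaI of_nat_diff Suc_leI flip: of_nat_sum)
  then show ?thesis
    by (simp add: quad_char_def sum_subtractf)
qed

lemma quad_char_solutions:
  fixes a c :: "'a::{field,finite}"
  assumes "a \<noteq> 0"
  shows "int (card {x. a * x\<^sup>2 = c}) = 1 + quad_char (a * c)"
proof -
  have "{x. a * x\<^sup>2 = c} = {x. (a * x)\<^sup>2 = a * c}"
    using assms by (auto simp: power2_eq_square)
  moreover have "bij_betw (\<lambda>x. a * x) {x. (a * x)\<^sup>2 = a * c} {y. y\<^sup>2 = a * c}"
    by (rule bij_betw_byWitness[of _ "\<lambda>y. y / a"]) (use assms in auto)
  ultimately show ?thesis by (simp add: quad_char_def bij_betw_same_card)
qed

text \<open>For each y there are 1 + chi(a (c - b y^2)) values of x, and pulling out chi(-ab) leaves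
  the shifted square y^2 - c/b. At c = 0 the character sum is q - 1 instead of -1: the zeros then
  form two lines or only the origin.\<close>

lemma card_binary_diagonal_form:
  fixes a b c :: "'a::{field,finite}"
  assumes 2: "(2::'a) \<noteq> 0" and a: "a \<noteq> 0" and b: "b \<noteq> 0"
  shows "int (card {(x, y). a * x\<^sup>2 + b * y\<^sup>2 = c}) =
    int CARD('a) - quad_char (- (a * b)) + (if c = 0 then int CARD('a) * quad_char (- (a * b)) else 0)"
proof -
  let ?q = "int CARD('a)" and ?h = "quad_char (- (a * b))"
  have "{(x, y). a * x\<^sup>2 + b * y\<^sup>2 = c} = prod.swap ` (SIGMA y:UNIV. {x. a * x\<^sup>2 = c - b * y\<^sup>2})"
    by (auto simp: image_iff algebra_simps)
  then have "int (card {(x, y). a * x\<^sup>2 + b * y\<^sup>2 = c}) = (\<Sum>y\<in>UNIV. int (card {x. a * x\<^sup>2 = c - b * y\<^sup>2}))"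
    by (simp add: card_image card_SigmaI)
  also have "\<dots> = (\<Sum>y\<in>UNIV. 1 + ?h * quad_char (y\<^sup>2 + - c / b))"
  proof (rule sum.cong[OF refl])
    fix y :: 'a
    have "a * (c - b * y\<^sup>2) = - (a * b) * (y\<^sup>2 + - c / b)" using b by (simp add: field_simps)
    then show "int (card {x. a * x\<^sup>2 = c - b * y\<^sup>2}) = 1 + ?h * quad_char (y\<^sup>2 + - c / b)"
      by (simp only: quad_char_solutions[OF a] quad_char_mult[OF 2])
  qed
  also have "\<dots> = ?q + ?h * (\<Sum>y\<in>UNIV. quad_char (y\<^sup>2 + - c / b))"
    by (simp add: sum.distrib sum_distrib_left)
  also have "(\<Sum>y\<in>UNIV. quad_char (y\<^sup>2 + - c / b)) = (if c = 0 then ?q - 1 else -1)"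
  proof (cases "c = 0")
    case True
    have "(\<Sum>y\<in>UNIV. quad_char (y\<^sup>2 :: 'a)) = (\<Sum>y\<in>UNIV - {0::'a}. 1)"
      by (rule sum.mono_neutral_cong_right) (auto simp: quad_char_square[OF 2])
    with True show ?thesis by (simp add: of_nat_diff Suc_leI)
  qed (use b in \<open>simp add: sum_quad_char_shifted_square[OF 2, of "- c / b", simplified]\<close>)
  finally show ?thesis by (simp add: algebra_simps)
qed

text \<open>The coefficient \<open>e\<close> may be 0, which is how forms of rank two enter. With h
  = chi(-ab), each slice of constant z has q - h points, and q h more when e z^2 = c.\<close>

lemma card_ternary_diagonal_form:
  fixes a b e c :: "'a::{field,finite}"
  assumes 2: "(2::'a) \<noteq> 0" and a: "a \<noteq> 0" and b: "b \<noteq> 0"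
  shows "int (card {(x, y, z). a * x\<^sup>2 + b * y\<^sup>2 + e * z\<^sup>2 = c}) =
    int CARD('a) ^ 2 - int CARD('a) * quad_char (- (a * b))
     + int CARD('a) * quad_char (- (a * b)) * int (card {z. e * z\<^sup>2 = c})"
proof -
  let ?q = "int CARD('a)" and ?h = "quad_char (- (a * b))"
  have "bij_betw (\<lambda>(z, x, y). (x, y, z)) (SIGMA z:UNIV. {(x, y). a * x\<^sup>2 + b * y\<^sup>2 = c - e * z\<^sup>2})
      {(x, y, z). a * x\<^sup>2 + b * y\<^sup>2 + e * z\<^sup>2 = c}"
    by (rule bij_betw_byWitness[of _ "\<lambda>(x, y, z). (z, x, y)"]) (auto simp: algebra_simps)
  then have "int (card {(x, y, z). a * x\<^sup>2 + b * y\<^sup>2 + e * z\<^sup>2 = c}) =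
      (\<Sum>z\<in>UNIV. int (card {(x, y). a * x\<^sup>2 + b * y\<^sup>2 = c - e * z\<^sup>2}))"
    by (simp add: card_SigmaI flip: bij_betw_same_card)
  also have "\<dots> = (\<Sum>z\<in>(UNIV::'a set). ?q - ?h) + (\<Sum>z\<in>UNIV. if e * z\<^sup>2 = c then ?q * ?h else 0)"
    unfolding card_binary_diagonal_form[OF assms] sum.distrib[symmetric]
    by (simp add: eq_commute[of c])
  also have "(\<Sum>z\<in>UNIV. if e * z\<^sup>2 = c then ?q * ?h else 0) = ?q * ?h * int (card {z. e * z\<^sup>2 = c})"
    by (simp flip: sum.inter_filter)
  finally show ?thesis by (simp add: algebra_simps power2_eq_square)
qed

section \<open>Diagonalisation of ternary quadratic forms\<close>

definition cross3 :: "'k::comm_ring_1 ^ 3 \<Rightarrow> 'k ^ 3 \<Rightarrow> 'k ^ 3" where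
  "cross3 u v = vector [u$2 * v$3 - u$3 * v$2, u$3 * v$1 - u$1 * v$3, u$1 * v$2 - u$2 * v$1]"

abbreviation bilin :: "'k::field ^ 3 ^ 3 \<Rightarrow> 'k ^ 3 \<Rightarrow> 'k ^ 3 \<Rightarrow> 'k" where
  "bilin A u v \<equiv> scalar_product u (A *v v)"

lemma scalar_product_cross3:
  "scalar_product u (cross3 u v) = 0" "scalar_product v (cross3 u v) = 0"
  by (simp_all add: cross3_def scalar_product_def sum_3 algebra_simps)

lemma det_rows_cross3:
  "det (vector [u, v, cross3 x y] :: 'k::comm_ring_1 ^ 3 ^ 3) =
    scalar_product u x * scalar_product v y - scalar_product u y * scalar_product v x"
  by (simp add: det_3 cross3_def scalar_product_def sum_3 algebra_simps)

lemma symmetric_entries: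
  fixes A :: "'k::field ^ 3 ^ 3"
  assumes "transpose A = A"
  shows "A $ i $ j = A $ j $ i"
  using arg_cong[OF assms, of "\<lambda>B. B $ j $ i"] by (simp add: transpose_def)

lemma bilin_sym:
  fixes A :: "'k::field ^ 3 ^ 3"
  assumes "transpose A = A"
  shows "bilin A u v = bilin A v u"
  by (simp add: scalar_product_def matrix_vector_mult_def sum_3 algebra_simps
      symmetric_entries[OF assms, of 1 2] symmetric_entries[OF assms, of 1 3] symmetric_entries[OF assms, of 2 3])

lemma bilin_left: "bilin A u v = scalar_product (transpose A *v u) v"
  for A :: "'k::field ^ 3 ^ 3"
  by (simp add: scalar_product_def matrix_vector_mult_def transpose_def sum_3 algebra_simps)

lemma quad_form_add:
  fixes A :: "'k::field ^ 3 ^ 3"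
  assumes "transpose A = A"
  shows "quad_form A (u + v) = quad_form A u + quad_form A v + 2 * bilin A u v"
  by (simp add: quad_form_def scalar_product_def matrix_vector_mult_def sum_3 algebra_simps
      symmetric_entries[OF assms, of 1 2] symmetric_entries[OF assms, of 1 3] symmetric_entries[OF assms, of 2 3])

lemma quad_form_smult: "quad_form A (c *s v) = c\<^sup>2 * quad_form A v"
  for A :: "'k::field ^ 3 ^ 3"
  by (simp add: quad_form_def scalar_product_def matrix_vector_mult_def sum_3 algebra_simps power2_eq_square)

lemma quad_form_zero [simp]: "quad_form A 0 = 0"
  for A :: "'k::field ^ 3 ^ 3"
  by (simp add: quad_form_def scalar_product_def)

lemma bilin_axis: "bilin A (axis i 1) (axis j 1) = A $ i $ j"
  for A :: "'k::field ^ 3 ^ 3"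
proof -
  show ?thesis
    using exhaust_3[of i] exhaust_3[of j]
    by (elim disjE) (simp_all add: scalar_product_def matrix_vector_mult_def sum_3 axis_def)
qed

lemma quad_form_eq_0_imp_zero:
  fixes A :: "'k::field ^ 3 ^ 3"
  assumes "transpose A = A" "(2::'k) \<noteq> 0" "\<And>v. quad_form A v = (0::'k)"
  shows "A = 0"
proof -
  have "A $ i $ j = 0" for i j
    using quad_form_add[OF assms(1), of "axis i 1" "axis j 1"] assms(2,3) by (simp add: bilin_axis)
  then show ?thesis by (simp add: vec_eq_iff)
qed

lemma orthogonal_nonisotropic_or_rank_le_1:
  fixes A :: "'k::field ^ 3 ^ 3"
  assumes sym: "transpose A = A" and 2: "(2::'k) \<noteq> 0" and v: "quad_form A v \<noteq> 0"
  obtains w where "bilin A v w = 0" "quad_form A w \<noteq> 0"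
  | "\<And>i j. quad_form A v * A $ i $ j = (A *v v) $ i * (A *v v) $ j"
proof (cases "\<exists>w. bilin A v w = 0 \<and> quad_form A w \<noteq> 0")
  case False
  define a l where "a = quad_form A v" and "l = A *v v"
  \<comment> \<open>If no such \<open>w\<close> exists, \<open>a A - l l\<^sup>T\<close> vanishes as a quadratic form: its value at \<open>u\<close> is, up to the
    factor \<open>a\<close>, the value of \<open>A\<close> at the component of \<open>a u\<close> orthogonal to \<open>v\<close>.\<close>
  define B where "B = (\<chi> i j. a * A $ i $ j - l $ i * l $ j)"
  have Bs: "transpose B = B"
    using symmetric_entries[OF sym] by (simp add: B_def transpose_def vec_eq_iff mult.commute)
  have "quad_form B u = 0" for u
  proof -
    define s w where "s = bilin A v u" and "w = a *s u + (- s) *s v"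
    have lu: "s = scalar_product l u"
      unfolding s_def l_def by (simp add: bilin_left sym)
    have "bilin A v w = a * s - s * a"
      by (simp add: w_def s_def a_def quad_form_def scalar_product_def matrix_vector_mult_def sum_3 algebra_simps)
    then have "quad_form A w = 0" using False by auto
    moreover have "quad_form A w = a * (a * quad_form A u - s\<^sup>2)"
    proof -
      have "quad_form A w = a\<^sup>2 * quad_form A u + (- s)\<^sup>2 * a + 2 * (a * (- s) * bilin A u v)"
        unfolding w_def quad_form_add[OF sym] quad_form_smult
        by (simp add: a_def scalar_product_def matrix_vector_mult_def sum_3 algebra_simps)
      then show ?thesis unfolding bilin_sym[OF sym, of u] s_def[symmetric]
        by (simp add: algebra_simps power2_eq_square)
    qed
    moreover have "quad_form B u = a * quad_form A u - s\<^sup>2"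
      by (simp add: B_def lu quad_form_def scalar_product_def matrix_vector_mult_def sum_3 algebra_simps power2_eq_square)
    ultimately show ?thesis using v by (simp add: a_def)
  qed
  from quad_form_eq_0_imp_zero[OF Bs 2 this] that(2) show ?thesis
    by (simp add: B_def vec_eq_iff a_def l_def)
qed (use that in blast)

text \<open>The factor \<open>a\<close> is essential over a field that is not closed under square
  roots: a symmetric matrix of rank one is a multiple of some l l^T, but the multiple need not be a
  square. The choice l = 0 covers the zero matrix.\<close>

definition rank_le_1 :: "'k::field ^ 3 ^ 3 \<Rightarrow> bool" where
  "rank_le_1 A \<longleftrightarrow> (\<exists>a l. a \<noteq> 0 \<and> (\<forall>i j. a * A $ i $ j = l $ i * l $ j))"

lemma det_eq_0_if_rank_le_1:
  fixes A :: "'k::field ^ 3 ^ 3"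
  assumes "rank_le_1 A"
  shows "det A = 0"
proof -
  from assms obtain a l where a: "a \<noteq> 0" and *: "\<And>i j. a * A $ i $ j = l $ i * l $ j"
    unfolding rank_le_1_def by blast
  have "A $ i $ j = l $ i * l $ j / a" for i j
    using *[of i j] a by (simp add: field_simps)
  then show ?thesis by (simp add: det_3 mult_ac)
qed

lemma exists_orthogonal_pair:
  fixes A :: "'k::field ^ 3 ^ 3"
  assumes sym: "transpose A = A" and 2: "(2::'k) \<noteq> 0" and rank: "\<not> rank_le_1 A"
  obtains v w where "bilin A v w = 0" "quad_form A v \<noteq> 0" "quad_form A w \<noteq> 0"
proof (cases "\<exists>v. quad_form A v \<noteq> 0")
  case True
  then obtain v where v: "quad_form A v \<noteq> 0" by blast
  show ?thesis
  proof (rule orthogonal_nonisotropic_or_rank_le_1[OF sym 2 v])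
    assume "\<And>i j. quad_form A v * A $ i $ j = (A *v v) $ i * (A *v v) $ j"
    then have "rank_le_1 A" unfolding rank_le_1_def using v by blast
    with rank show ?thesis ..
  qed (use v that in blast)
next
  case False
  then have "A = 0" using quad_form_eq_0_imp_zero[OF sym 2] by blast
  then have "rank_le_1 A" unfolding rank_le_1_def by (intro exI[of _ 1] exI[of _ 0]) simp
  with rank show ?thesis ..
qed

text \<open>In contrast to \<open>exists_orthogonal_pair\<close>, the first vector is prescribed: it
  will represent the point whose tangents are sought, and the diagonalising basis has to start with
  it.\<close>

lemma exists_orthogonal_vector:
  fixes A :: "'k::field ^ 3 ^ 3"
  assumes sym: "transpose A = A" and 2: "(2::'k) \<noteq> 0" and det: "det A \<noteq> 0" and v: "quad_form A v \<noteq> 0"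
  obtains w where "bilin A v w = 0" "quad_form A w \<noteq> 0"
proof (rule orthogonal_nonisotropic_or_rank_le_1[OF sym 2 v])
  assume "\<And>i j. quad_form A v * A $ i $ j = (A *v v) $ i * (A *v v) $ j"
  then have "rank_le_1 A" unfolding rank_le_1_def using v by blast
  with det show ?thesis by (simp add: det_eq_0_if_rank_le_1)
qed

definition diag3 :: "'k::zero \<Rightarrow> 'k \<Rightarrow> 'k \<Rightarrow> 'k ^ 3 ^ 3" where
  "diag3 a b c = vector [vector [a, 0, 0], vector [0, b, 0], vector [0, 0, c]]"

lemma gram_entry: "(M ** A ** transpose M) $ i $ j = bilin A (M $ i) (M $ j)"
  for A :: "'k::field ^ 3 ^ 3"
  by (simp add: matrix_matrix_mult_def transpose_def scalar_product_def matrix_vector_mult_def sum_3 algebra_simps)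

lemma diagonalise:
  fixes A :: "'k::field ^ 3 ^ 3"
  assumes sym: "transpose A = A"
    and v: "bilin A v w = 0" "quad_form A v \<noteq> 0" "quad_form A w \<noteq> 0"
  obtains M :: "'k ^ 3 ^ 3" and e where "det M \<noteq> 0" "M $ 1 = v" "M ** A ** transpose M = diag3 (quad_form A v) (quad_form A w) e"
proof -
  \<comment> \<open>This \<open>u\<close> is orthogonal to \<open>v\<close> and \<open>w\<close>, and by the Binet-Cauchy identity the determinant of the
    three vectors is the Gram determinant of \<open>v\<close> and \<open>w\<close>.\<close>
  define u where "u = cross3 (A *v v) (A *v w)"
  define M :: "'k ^ 3 ^ 3" where "M = vector [v, w, u]"
  have wv: "bilin A w v = 0" using v(1) bilin_sym[OF sym] by metis
  have "det M = quad_form A v * quad_form A w"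
    unfolding M_def u_def det_rows_cross3 using v wv by (simp add: quad_form_def)
  then have 1: "det M \<noteq> 0" using v by simp
  have o: "bilin A v u = 0" "bilin A w u = 0" "bilin A u v = 0" "bilin A u w = 0"
    unfolding bilin_sym[OF sym, of u] unfolding bilin_left[of _ A] sym u_def by (simp_all add: scalar_product_cross3)
  have "M ** A ** transpose M = diag3 (quad_form A v) (quad_form A w) (quad_form A u)"
    by (simp add: vec_eq_iff forall_3 gram_entry M_def diag3_def o v wv quad_form_def)
  with 1 that show ?thesis by (simp add: M_def)
qed

lemma scalar_product_matrix_left: "scalar_product u (M *v x) = scalar_product (u v* M) x"
  for M :: "'k::field ^ 3 ^ 3"
  by (simp add: scalar_product_def matrix_vector_mult_def vector_matrix_mult_def sum_3 algebra_simps)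

lemma gram_mult_vector: "(M ** A ** transpose M) *v u = M *v (A *v (u v* M))"
  for A :: "'k::field ^ 3 ^ 3"
  by (simp flip: matrix_vector_mul_assoc)

text \<open>The rows of \<open>M\<close> play the role of the new basis, so \<open>u v* M\<close> is
  the vector with coordinates \<open>u\<close>.\<close>

lemma quad_form_transform: "quad_form (M ** A ** transpose M) u = quad_form A (u v* M)"
  for A :: "'k::field ^ 3 ^ 3"
  by (simp add: quad_form_def gram_mult_vector scalar_product_matrix_left)

lemma quad_form_diag3: "quad_form (diag3 a b c) u = a * (u $ 1)\<^sup>2 + b * (u $ 2)\<^sup>2 + c * (u $ 3)\<^sup>2"
  for a :: "'k::field"
  by (simp add: diag3_def quad_form_def scalar_product_def matrix_vector_mult_def sum_3 power2_eq_square algebra_simps)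

lemma det_diag3: "det (diag3 a b c) = a * b * (c::'k::field)"
  by (simp add: diag3_def det_3)

lemma bij_vector_matrix_mult:
  fixes M :: "'k::field ^ 3 ^ 3"
  assumes "det M \<noteq> 0"
  shows "bij (\<lambda>u. u v* M)"
proof -
  have "invertible M" using assms by (simp add: invertible_det_nz)
  then obtain N where N: "M ** N = mat 1" "N ** M = mat 1" unfolding invertible_def by blast
  show ?thesis
    by (rule bij_betw_byWitness[of _ "\<lambda>u. u v* N"])
       (simp_all add: vector_matrix_mul_assoc N)
qed

section \<open>Counting points in a pencil of conics\<close>

lemma card_quad_form_diagonal:
  fixes A M :: "'a::{field,finite} ^ 3 ^ 3"
  assumes M: "det M \<noteq> 0" "M ** A ** transpose M = diag3 a b e"
  shows "card {v. quad_form A v = c} = card {(x, y, z). a * x\<^sup>2 + b * y\<^sup>2 + e * z\<^sup>2 = c}"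
proof -
  let ?S = "{u :: 'a ^ 3. a * (u $ 1)\<^sup>2 + b * (u $ 2)\<^sup>2 + e * (u $ 3)\<^sup>2 = c}"
  have "bij_betw (\<lambda>u. u v* M) ?S {v. quad_form A v = c}"
    using bij_betw_Collect[OF bij_vector_matrix_mult[OF M(1)], of "\<lambda>v. quad_form A v = c"]
    by (simp add: M(2) quad_form_diag3 flip: quad_form_transform)
  moreover have "bij_betw (\<lambda>(x, y, z). vector [x, y, z]) {(x, y, z). a * x\<^sup>2 + b * y\<^sup>2 + e * z\<^sup>2 = c} ?S"
    by (rule bij_betw_byWitness[of _ "\<lambda>u. (u $ 1, u $ 2, u $ 3)"]) (auto simp: vec_eq_iff forall_3)
  ultimately show ?thesis by (auto dest!: bij_betw_same_card)
qed

text \<open>A change of basis multiplies the determinant by the square of \<open>det M\<close>,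
  which the character does not see.\<close>

lemma quad_char_det_diagonal:
  fixes A M :: "'a::{field,finite} ^ 3 ^ 3"
  assumes M: "det M \<noteq> 0" "M ** A ** transpose M = diag3 a b e"
  shows "quad_char (c * det A) = quad_char (c * (a * b * e))"
proof -
  have "a * b * e = (det M)\<^sup>2 * det A"
    using arg_cong[OF M(2), of det] by (simp add: det_diag3 det_mul det_transpose power2_eq_square mult_ac)
  then have "c * (a * b * e) = (det M)\<^sup>2 * (c * det A)" by (simp add: mult_ac)
  then show ?thesis using quad_char_mult_square[OF M(1)] by metis
qed

text \<open>For nonzero \<open>e\<close> only the slice z = 0 is exceptional. Its surplus q h
  compensates exactly for the deficit h in each of the q slices.\<close>

lemma card_quad_form_eq_0:
  fixes A :: "'a::{field,finite} ^ 3 ^ 3"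
  assumes 2: "(2::'a) \<noteq> 0" and sym: "transpose A = A" and det: "det A \<noteq> 0"
  shows "int (card {v. quad_form A v = 0}) = int CARD('a) ^ 2"
proof -
  have "\<not> rank_le_1 A" using det det_eq_0_if_rank_le_1 by blast
  from exists_orthogonal_pair[OF sym 2 this]
  obtain v w where vw: "bilin A v w = 0" "quad_form A v \<noteq> 0" "quad_form A w \<noteq> 0" by blast
  obtain M e where M: "det M \<noteq> 0" "M $ 1 = v"
      "M ** A ** transpose M = diag3 (quad_form A v) (quad_form A w) e"
    by (rule diagonalise[OF sym vw])
  note M = M(1,3)
  have "e \<noteq> 0"
    using arg_cong[OF M(2), of det] M(1) det by (auto simp: det_diag3 det_mul det_transpose)
  then show ?thesis
    unfolding card_quad_form_diagonal[OF M] card_ternary_diagonal_form[OF 2 vw(2,3)]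
    by simp
qed

lemma card_quad_form_levels:
  fixes A :: "'a::{field,finite} ^ 3 ^ 3"
  assumes 2: "(2::'a) \<noteq> 0" and sym: "transpose A = A" and rank: "\<not> rank_le_1 A" and c: "c \<noteq> 0"
  defines "q \<equiv> int CARD('a)"
  shows "(q - 1) * int (card {v. quad_form A v = c}) + int (card {v. quad_form A v = 0}) =
    q ^ 3 + q * (q - 1) * quad_char (- c * det A)"
proof -
  from exists_orthogonal_pair[OF sym 2 rank]
  obtain v w where vw: "bilin A v w = 0" "quad_form A v \<noteq> 0" "quad_form A w \<noteq> 0" by blast
  obtain M e where M: "det M \<noteq> 0" "M $ 1 = v"
      "M ** A ** transpose M = diag3 (quad_form A v) (quad_form A w) e"
    by (rule diagonalise[OF sym vw])
  note M = M(1,3)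
  define a b h where "a = quad_form A v" and "b = quad_form A w" and "h = quad_char (- (a * b))"
  note N = card_quad_form_diagonal[OF M, folded a_def b_def]
    card_ternary_diagonal_form[OF 2 vw(2,3), folded a_def b_def, folded h_def q_def]
  have "quad_char (- c * det A) = quad_char (- (a * b) * (e * c))"
    unfolding quad_char_det_diagonal[OF M] by (simp add: a_def b_def mult_ac)
  then have ch: "quad_char (- c * det A) = h * quad_char (e * c)"
    by (simp only: quad_char_mult[OF 2] h_def)
  \<comment> \<open>In rank two, every z solves e z^2 = 0 and none solves e z^2 = c; the terms in
    \<open>h\<close> cancel and the character of det A = 0 vanishes. In rank three there are 1 and 1
    + chi(e c) solutions, and the only term in \<open>h\<close> that survives is q (q - 1) h chi(e
    c).\<close>
  show ?thesis
  proof (cases "e = 0")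
    case True
    then have "card {z. e * z\<^sup>2 = 0} = CARD('a)" "card {z. e * z\<^sup>2 = c} = 0" using c by auto
    then show ?thesis unfolding N ch using True
      by (simp add: q_def algebra_simps power2_eq_square power3_eq_cube)
  next
    case False
    then have "int (card {z. e * z\<^sup>2 = 0}) = 1" "int (card {z. e * z\<^sup>2 = c}) = 1 + quad_char (e * c)"
      using quad_char_solutions by auto
    then show ?thesis unfolding N ch by (simp add: algebra_simps power2_eq_square power3_eq_cube)
  qed
qed

definition pencil :: "'k::field ^ 3 ^ 3 \<Rightarrow> 'k ^ 3 ^ 3 \<Rightarrow> 'k \<Rightarrow> 'k ^ 3 ^ 3" where
  "pencil C D x = (\<chi> i j. x * C $ i $ j + D $ i $ j)"

lemma quad_form_pencil: "quad_form (pencil C D x) v = x * quad_form C v + quad_form D v"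
  by (simp add: pencil_def quad_form_def scalar_product_def matrix_vector_mult_def sum_3 algebra_simps)

lemma transpose_pencil:
  fixes C D :: "'k::field ^ 3 ^ 3"
  assumes "transpose C = C" "transpose D = D"
  shows "transpose (pencil C D x) = pencil C D x"
proof -
  have "C $ j $ i = C $ i $ j" "D $ j $ i = D $ i $ j" for i j
    using symmetric_entries assms by blast+
  then show ?thesis by (simp add: pencil_def transpose_def vec_eq_iff)
qed

lemma sum_card_pencil:
  fixes C D :: "'a::{field,finite} ^ 3 ^ 3"
  shows "(\<Sum>x\<in>UNIV. int (card {v. quad_form (pencil C D x) v = c})) =
    int CARD('a) ^ 3 - int (card {v. quad_form C v = 0})
      + int CARD('a) * int (card {v. quad_form C v = 0 \<and> quad_form D v = c})"
proof -
  let ?q = "int CARD('a)"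
  have "(\<Sum>x\<in>UNIV. int (card {v. quad_form (pencil C D x) v = c})) =
      (\<Sum>x\<in>(UNIV::'a set). \<Sum>v\<in>(UNIV::('a^3) set). if quad_form (pencil C D x) v = c then 1 else 0)"
    by (simp flip: sum.inter_filter)
  also have "\<dots> = (\<Sum>v\<in>(UNIV::('a^3) set). \<Sum>x\<in>(UNIV::'a set). if quad_form (pencil C D x) v = c then 1 else 0)"
    by (rule sum.swap)
  also have "\<dots> = (\<Sum>v\<in>(UNIV::('a^3) set). 1 - (if quad_form C v = 0 then 1 else 0)
      + ?q * (if quad_form C v = 0 \<and> quad_form D v = c then 1 else 0))"
  proof (rule sum.cong[OF refl])
    fix v :: "'a ^ 3"
    have "(\<Sum>x\<in>(UNIV::'a set). if quad_form (pencil C D x) v = c then 1 else 0 :: int) =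
        int (card {x. x * quad_form C v + quad_form D v = c})"
      by (simp add: quad_form_pencil flip: sum.inter_filter)
    \<comment> \<open>A vector with C(v) = 0 imposes no condition on x, so it counts q times or not
      at all. The q-fold ones carry the information about C and D together.\<close>
    also have "{x. x * quad_form C v + quad_form D v = c} =
        (if quad_form C v = 0 then if quad_form D v = c then UNIV else {}
         else {(c - quad_form D v) / quad_form C v})"
      by (auto simp: field_simps)
    finally show "(\<Sum>x\<in>(UNIV::'a set). if quad_form (pencil C D x) v = c then 1 else 0 :: int) =
        1 - (if quad_form C v = 0 then 1 else 0) + ?q * (if quad_form C v = 0 \<and> quad_form D v = c then 1 else 0)"
      by simp
  qed
  also have "\<dots> = int CARD('a ^ 3) - int (card {v. quad_form C v = 0})
      + ?q * int (card {v. quad_form C v = 0 \<and> quad_form D v = c})"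
    by (simp add: sum.distrib sum_subtractf flip: sum_distrib_left sum.inter_filter)
  finally show ?thesis by simp
qed

text \<open>In the double count, level 0 contributes the common zeros of C and D, hence
  \<open>b\<close>, and level -det D contributes the wanted cardinality. The summand 1 in the
  premise on \<open>b\<close> is the zero vector. Once #{C = 0} = q^2 is inserted, a factor q (q -
  1) can be cancelled.\<close>

lemma pencil_count:
  fixes C D :: "'a::{field,finite} ^ 3 ^ 3"
  assumes 2: "(2::'a) \<noteq> 0" and sym: "transpose C = C" "transpose D = D"
    and det: "det C \<noteq> 0" "det D \<noteq> 0"
    and rank: "\<And>x. \<not> rank_le_1 (pencil C D x)"
    and b: "int (card {v. quad_form C v = 0 \<and> quad_form D v = 0}) = 1 + (int CARD('a) - 1) * b"
  shows "int (card {v. quad_form C v = 0 \<and> quad_form D v = - det D}) =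
    int CARD('a) + 1 - b + (\<Sum>x\<in>UNIV. quad_char (det D * det (pencil C D x)))"
proof -
  let ?q = "int CARD('a)" and ?T = "\<Sum>x\<in>UNIV. quad_char (det D * det (pencil C D x))"
    and ?W = "int (card {v. quad_form C v = 0 \<and> quad_form D v = - det D})"
    and ?N = "\<lambda>c x. int (card {v. quad_form (pencil C D x) v = c})"
  have arith: "q * (q - 1) * W = q * (q - 1) * (q + 1 - b + T)"
    if "(q - 1) * (q ^ 3 - q ^ 2 + q * W) + (q ^ 3 - q ^ 2 + q * (1 + (q - 1) * b)) = q * q ^ 3 + q * (q - 1) * T"
    for q W b T :: int
    using that by (simp add: algebra_simps power2_eq_square power3_eq_cube)
  have "(?q - 1) * (\<Sum>x\<in>UNIV. ?N (- det D) x) + (\<Sum>x\<in>UNIV. ?N 0 x) =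
      (\<Sum>x\<in>(UNIV::'a set). (?q - 1) * ?N (- det D) x + ?N 0 x)"
    by (simp add: sum.distrib sum_distrib_left)
  also have "\<dots> = (\<Sum>x\<in>(UNIV::'a set). ?q ^ 3 + ?q * (?q - 1) * quad_char (det D * det (pencil C D x)))"
    using card_quad_form_levels[OF 2 transpose_pencil[OF sym] rank, of "- det D"] det(2)
    by (intro sum.cong refl) simp
  also have "\<dots> = ?q * ?q ^ 3 + ?q * (?q - 1) * ?T"
    by (simp add: sum.distrib sum_distrib_left)
  finally have "(?q - 1) * (?q ^ 3 - ?q ^ 2 + ?q * ?W) + (?q ^ 3 - ?q ^ 2 + ?q * (1 + (?q - 1) * b)) =
      ?q * ?q ^ 3 + ?q * (?q - 1) * ?T"
    by (simp only: sum_card_pencil card_quad_form_eq_0[OF 2 sym(1) det(1)] b)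
  then have "?q * (?q - 1) * ?W = ?q * (?q - 1) * (?q + 1 - b + ?T)"
    by (rule arith)
  moreover have "?q * (?q - 1) \<noteq> 0" using card_gt_1[where ?'a = 'a] by simp
  ultimately show ?thesis using mult_cancel_left[THEN iffD1] by blast
qed

section \<open>Projective points counted through their representatives\<close>

lemma proj_point_eq_iff:
  fixes v w :: "'k::field ^ 3"
  assumes "v \<noteq> 0" "w \<noteq> 0"
  shows "proj_point v = proj_point w \<longleftrightarrow> (\<exists>c. c \<noteq> 0 \<and> w = c *s v)"
proof
  assume "proj_point v = proj_point w"
  moreover have "w \<in> proj_point w" unfolding proj_point_def by (metis (mono_tags) mem_Collect_eq vector_smult_lid)
  ultimately obtain c where "w = c *s v" unfolding proj_point_def by blast
  with assms show "\<exists>c. c \<noteq> 0 \<and> w = c *s v" by auto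
next
  assume "\<exists>c. c \<noteq> 0 \<and> w = c *s v"
  then obtain c where c: "c \<noteq> 0" "w = c *s v" by blast
  have "d *s v = (d / c) *s w" "d *s w = (d * c) *s v" for d
    using c by (simp_all add: vector_smult_assoc)
  then show "proj_point v = proj_point w" unfolding proj_point_def by blast
qed

lemma card_proj_points:
  fixes S :: "('a::{field,finite} ^ 3) set"
  assumes S: "0 \<notin> S" "\<And>c v. c \<noteq> 0 \<Longrightarrow> v \<in> S \<Longrightarrow> c *s v \<in> S"
  shows "int (card S) = (int CARD('a) - 1) * int (card (proj_point ` S))"
proof -
  have "card S = (\<Sum>P\<in>proj_point ` S. card {v \<in> S. proj_point v = P})"
    using sum.image_gen[of S "\<lambda>_. 1::nat" proj_point] by simp
  also have "\<dots> = (\<Sum>P\<in>proj_point ` S. CARD('a) - 1)"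
  proof (rule sum.cong[OF refl])
    fix P assume "P \<in> proj_point ` S"
    then obtain w where w: "w \<in> S" "P = proj_point w" by blast
    then have "w \<noteq> 0" using S by auto
    have "{v \<in> S. proj_point v = P} = (\<lambda>c. c *s w) ` (UNIV - {0})"
    proof (intro equalityI subsetI)
      fix v assume "v \<in> {v \<in> S. proj_point v = P}"
      then have "v \<in> S" "proj_point w = proj_point v" using w by auto
      moreover then have "v \<noteq> 0" using S by auto
      ultimately show "v \<in> (\<lambda>c. c *s w) ` (UNIV - {0})"
        using proj_point_eq_iff[OF \<open>w \<noteq> 0\<close>] by auto
    next
      fix v assume "v \<in> (\<lambda>c. c *s w) ` (UNIV - {0})"
      then obtain c where c: "c \<noteq> 0" "v = c *s w" by auto
      then have "v \<in> S" using S w by auto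
      moreover then have "v \<noteq> 0" using S by auto
      ultimately show "v \<in> {v \<in> S. proj_point v = P}"
        using proj_point_eq_iff[OF \<open>w \<noteq> 0\<close>, of v] c w by blast
    qed
    moreover have "inj (\<lambda>c. c *s w)"
      using \<open>w \<noteq> 0\<close> by (auto simp: inj_on_def)
    ultimately show "card {v \<in> S. proj_point v = P} = CARD('a) - 1"
      by (simp add: card_image inj_on_subset)
  qed
  finally show ?thesis by (simp add: of_nat_diff Suc_leI)
qed

lemma proj_point_in_conic:
  fixes A :: "'k::field ^ 3 ^ 3"
  assumes "v \<noteq> 0"
  shows "proj_point v \<in> conic A \<longleftrightarrow> quad_form A v = 0"
proof
  assume "proj_point v \<in> conic A"
  then obtain w where w: "w \<noteq> 0" "quad_form A w = 0" "proj_point w = proj_point v"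
    unfolding conic_def by auto
  then obtain c where "v = c *s w" using proj_point_eq_iff[OF w(1) assms] by auto
  with w show "quad_form A v = 0" by (simp add: quad_form_smult)
qed (use assms in \<open>auto simp: conic_def\<close>)

lemma conic_eq_image: "conic A = proj_point ` {v. v \<noteq> 0 \<and> quad_form A v = 0}"
  by (auto simp: conic_def)

lemma card_conic:
  fixes A :: "'a::{field,finite} ^ 3 ^ 3"
  assumes 2: "(2::'a) \<noteq> 0" and sym: "transpose A = A" and det: "det A \<noteq> 0"
  shows "card (conic A) = CARD('a) + 1"
proof -
  let ?q = "int CARD('a)" and ?S = "{v. v \<noteq> 0 \<and> quad_form A v = 0}"
  have "insert 0 ?S = {v. quad_form A v = 0}" by auto
  then have "int (card {v. quad_form A v = 0}) = 1 + int (card ?S)"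
    using card_insert_disjoint[of ?S 0] by simp
  then have "?q ^ 2 = 1 + int (card ?S)"
    unfolding card_quad_form_eq_0[OF assms] .
  also have "int (card ?S) = (?q - 1) * int (card (conic A))"
    unfolding conic_eq_image by (rule card_proj_points) (auto simp: quad_form_smult)
  finally have "(?q - 1) * int (card (conic A)) = (?q - 1) * (?q + 1)"
    by (simp add: algebra_simps power2_eq_square)
  moreover have "?q - 1 \<noteq> 0" using card_gt_1[where ?'a = 'a] by simp
  ultimately have "int (card (conic A)) = ?q + 1" using mult_cancel_left[THEN iffD1] by blast
  then show ?thesis by simp
qed

lemma card_common_zeros:
  fixes C D :: "'a::{field,finite} ^ 3 ^ 3"
  shows "int (card {v. quad_form C v = 0 \<and> quad_form D v = 0}) =
    1 + (int CARD('a) - 1) * int (card (conic C \<inter> conic D))"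
proof -
  let ?S = "{v. v \<noteq> 0 \<and> quad_form C v = 0 \<and> quad_form D v = 0}"
  have "insert 0 ?S = {v. quad_form C v = 0 \<and> quad_form D v = 0}" by auto
  then have "int (card {v. quad_form C v = 0 \<and> quad_form D v = 0}) = 1 + int (card ?S)"
    using card_insert_disjoint[of ?S 0] by simp
  also have "int (card ?S) = (int CARD('a) - 1) * int (card (proj_point ` ?S))"
    by (rule card_proj_points) (auto simp: quad_form_smult)
  also have "proj_point ` ?S = conic C \<inter> conic D"
  proof (intro equalityI subsetI)
    fix P assume P: "P \<in> conic C \<inter> conic D"
    then obtain v where v: "v \<noteq> 0" "quad_form C v = 0" "P = proj_point v"
      unfolding conic_def by blast
    with P show "P \<in> proj_point ` ?S" by (auto simp: proj_point_in_conic)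
  qed (auto simp: proj_point_in_conic)
  finally show ?thesis .
qed

text \<open>Scaling v by d multiplies D(v) by d^2. If c D(v) = s^2 with s nonzero, then d = c / s
  moves v to level c, and only the opposite vector on the same line shares that level.\<close>

lemma card_level_on_conic:
  fixes C D :: "'a::{field,finite} ^ 3 ^ 3"
  assumes 2: "(2::'a) \<noteq> 0" and c: "c \<noteq> 0"
  shows "card {v. quad_form C v = 0 \<and> quad_form D v = c} =
    2 * card (proj_point ` {v. v \<noteq> 0 \<and> quad_form C v = 0 \<and> quad_char (c * quad_form D v) = 1})"
proof -
  let ?W = "{v. quad_form C v = 0 \<and> quad_form D v = c}"
    and ?X = "{v. v \<noteq> 0 \<and> quad_form C v = 0 \<and> quad_char (c * quad_form D v) = 1}"
  have W0: "v \<noteq> 0" if "v \<in> ?W" for v using that c by auto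
  have "proj_point ` ?W = proj_point ` ?X"
  proof (intro equalityI image_subsetI)
    fix v assume v: "v \<in> ?W"
    then have "quad_char (c * quad_form D v) = 1"
      using quad_char_square[OF 2 c] by (simp add: power2_eq_square)
    then show "proj_point v \<in> proj_point ` ?X" using v W0[OF v] by auto
  next
    fix v assume v: "v \<in> ?X"
    then have *: "quad_char (c * quad_form D v) = 1" by simp
    obtain s where s: "s \<noteq> 0" "c * quad_form D v = s\<^sup>2"
      by (rule quad_char_cases[OF 2, of "c * quad_form D v"]) (use * in auto)
    define w where "w = (c / s) *s v"
    have "quad_form D w = c * (c * quad_form D v) / s\<^sup>2"
      by (simp add: w_def quad_form_smult power2_eq_square)
    also have "\<dots> = c" using s by simp
    finally have "w \<in> ?W" using v by (simp add: w_def quad_form_smult)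
    moreover have "proj_point v = proj_point w"
      using proj_point_eq_iff[of v w] v W0[OF \<open>w \<in> ?W\<close>] c s by (auto simp: w_def)
    ultimately show "proj_point v \<in> proj_point ` ?W" by auto
  qed
  moreover have "card ?W = (\<Sum>P\<in>proj_point ` ?W. card {v \<in> ?W. proj_point v = P})"
    using sum.image_gen[of ?W "\<lambda>_. 1::nat" proj_point] by simp
  moreover have "\<dots> = (\<Sum>P\<in>proj_point ` ?W. 2)"
  proof (rule sum.cong[OF refl])
    fix P assume "P \<in> proj_point ` ?W"
    then obtain w where w: "w \<in> ?W" "P = proj_point w" by blast
    have "{v \<in> ?W. proj_point v = P} = {w, (-1) *s w}"
    proof (intro equalityI subsetI)
      fix v assume v: "v \<in> {v \<in> ?W. proj_point v = P}"
      then obtain d where d: "v = d *s w" using proj_point_eq_iff[of w v] w W0 by auto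
      then have "d\<^sup>2 * c = c" using v w by (auto simp: quad_form_smult)
      then have "d = 1 \<or> d = -1" using c by (simp add: power2_eq_1_iff)
      then show "v \<in> {w, (-1) *s w}" using d by auto
    next
      fix v assume "v \<in> {w, (-1) *s w}"
      then obtain d where d: "v = d *s w" "d\<^sup>2 = 1" "d \<noteq> 0"
        using that[of 1] that[of "-1"] by auto
      then have "v \<in> ?W" using w by (simp add: quad_form_smult)
      with d show "v \<in> {v \<in> ?W. proj_point v = P}"
        using proj_point_eq_iff[of w v] W0[OF w(1)] W0[OF \<open>v \<in> ?W\<close>] w by auto
    qed
    moreover have "w \<noteq> (-1) *s w"
    proof
      assume "w = (-1) *s w"
      then have "w $ i = - w $ i" for i by (metis mult_minus1 vector_smult_component)
      then have "w = 0" using neg_neq_self[OF 2] by (metis vec_eq_iff zero_index)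
      with W0[OF w(1)] show False ..
    qed
    ultimately show "card {v \<in> ?W. proj_point v = P} = 2" by simp
  qed
  ultimately show ?thesis by simp
qed

section \<open>The cubic of the pencil\<close>

lemma poly_pencil_cubic: "poly (pencil_cubic C D) x = det D * det (pencil C D x)"
  by (simp add: pencil_cubic_def pencil_def det_3 algebra_simps)

text \<open>A determinant of order three with linear entries is a signed sum of six such products.
  Its coefficient of degree three is thus the determinant of the slopes, which for the pencil is det
  C.\<close>

lemma product_of_three_linear:
  fixes a b c d e f :: "'k::comm_ring_1"
  shows "Polynomial.coeff ([:a, b:] * [:c, d:] * [:e, f:]) 3 = b * d * f"
    and "degree ([:a, b:] * [:c, d:] * [:e, f:]) \<le> 3"
proof -
  have *: "[:a, b:] * [:c, d:] * [:e, f:] =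
      [:a * c * e, a * c * f + a * d * e + b * c * e, a * d * f + b * c * f + b * d * e, b * d * f:]"
    by (simp add: algebra_simps)
  show "Polynomial.coeff ([:a, b:] * [:c, d:] * [:e, f:]) 3 = b * d * f"
    unfolding * by (simp add: eval_nat_numeral)
  show "degree ([:a, b:] * [:c, d:] * [:e, f:]) \<le> 3"
    unfolding * by (intro degree_le) (simp add: coeff_pCons split: nat.splits)
qed

lemma coeff_pencil_cubic_3: "Polynomial.coeff (pencil_cubic C D) 3 = det D * det C"
  by (simp only: pencil_cubic_def det_3 vec_lambda_beta coeff_smult coeff_add coeff_diff product_of_three_linear)

lemma degree_pencil_cubic_le: "degree (pencil_cubic C D) \<le> 3"
  unfolding pencil_cubic_def det_3 vec_lambda_beta
  by (intro order.trans[OF degree_smult_le] degree_diff_le degree_add_le product_of_three_linear)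

text \<open>At z = 0 the equation reduces to 0 = c x^3 with c the nonzero leading coefficient, so x
  = 0 and [0:1:0] is the only point there. Any other point is normalised to z = 1.\<close>

lemma cubic_model_eq:
  fixes g :: "'k::field poly"
  assumes deg: "degree g \<le> 3" and lead: "Polynomial.coeff g 3 \<noteq> 0"
  shows "cubic_model g = insert (proj_point (vector [0, 1, 0]))
    ((\<lambda>(x, y). proj_point (vector [x, y, 1])) ` (SIGMA x:UNIV. {y. y\<^sup>2 = poly g x}))"
proof -
  define c where "c = Polynomial.coeff g"
  have poly: "poly g x = c 0 + c 1 * x + c 2 * x\<^sup>2 + c 3 * x ^ 3" for x
  proof -
    have "poly g x = (\<Sum>i\<le>3. Polynomial.coeff g i * x ^ i)"
      unfolding poly_altdef by (rule sum.mono_neutral_left) (use deg in \<open>auto simp: coeff_eq_0\<close>)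
    then show ?thesis by (simp add: c_def eval_nat_numeral)
  qed
  have hom: "(\<Sum>i\<le>3. Polynomial.coeff g i * x ^ i * z ^ (3 - i)) =
      c 0 * z ^ 3 + c 1 * x * z\<^sup>2 + c 2 * x\<^sup>2 * z + c 3 * x ^ 3" for x z
    by (simp add: c_def eval_nat_numeral)
  have nz: "vector [x, y, z] \<noteq> (0::'k ^ 3) \<longleftrightarrow> (x, y, z) \<noteq> (0, 0, 0)" for x y z
    by (auto simp: vec_eq_iff forall_3)
  have scale: "proj_point (vector [x, y, z]) = proj_point (vector [d * x, d * y, d * z])"
    if "d \<noteq> 0" "(x, y, z) \<noteq> (0, 0, 0)" for d x y z :: 'k
  proof (subst proj_point_eq_iff)
    show "\<exists>c. c \<noteq> 0 \<and> (vector [d * x, d * y, d * z] :: 'k ^ 3) = c *s vector [x, y, z]"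
      using that by (intro exI[of _ d]) (simp add: vec_eq_iff forall_3)
  qed (use that in \<open>simp_all only: nz, auto\<close>)
  show ?thesis
  proof (intro equalityI subsetI)
    fix P assume "P \<in> cubic_model g"
    then obtain x y z where P: "P = proj_point (vector [x, y, z])" "(x, y, z) \<noteq> (0, 0, 0)"
      and eq: "y ^ 2 * z = c 0 * z ^ 3 + c 1 * x * z\<^sup>2 + c 2 * x\<^sup>2 * z + c 3 * x ^ 3"
      unfolding cubic_model_def hom by blast
    show "P \<in> insert (proj_point (vector [0, 1, 0]))
      ((\<lambda>(x, y). proj_point (vector [x, y, 1])) ` (SIGMA x:UNIV. {y. y\<^sup>2 = poly g x}))"
    proof (cases "z = 0")
      case True
      with eq lead have "x = 0" by (simp add: c_def)
      with True P(2) have "y \<noteq> 0" by simp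
      with scale[of "1 / y" x y z] P True \<open>x = 0\<close> show ?thesis by simp
    next
      case False
      have "(y / z)\<^sup>2 = y ^ 2 * z / z ^ 3"
        using False by (simp add: power2_eq_square power3_eq_cube)
      also have "\<dots> = poly g (x / z)"
        unfolding eq poly using False by (simp add: field_simps power2_eq_square power3_eq_cube)
      finally have "(x / z, y / z) \<in> (SIGMA x:UNIV. {y. y\<^sup>2 = poly g x})" by simp
      moreover have "P = proj_point (vector [x / z, y / z, 1])"
        using scale[of "1 / z" x y z] P False by simp
      ultimately show ?thesis by (metis (no_types, lifting) case_prod_conv image_eqI insertI2)
    qed
  next
    fix P assume "P \<in> insert (proj_point (vector [0, 1, 0]))
      ((\<lambda>(x, y). proj_point (vector [x, y, 1])) ` (SIGMA x:UNIV. {y. y\<^sup>2 = poly g x}))"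
    then obtain x y z where "P = proj_point (vector [x, y, z])" "(x, y, z) \<noteq> (0, 0, 0)"
        "y ^ 2 * z = c 0 * z ^ 3 + c 1 * x * z\<^sup>2 + c 2 * x\<^sup>2 * z + c 3 * x ^ 3"
    proof (elim insertE imageE SigmaE2 SigmaE)
      assume "P = proj_point (vector [0, 1, 0])"
      then show thesis using that[of 0 1 0] by simp
    next
      fix p x y assume "P = (case p of (x, y) \<Rightarrow> proj_point (vector [x, y, 1]))" "y \<in> {y. y\<^sup>2 = poly g x}" "p = (x, y)"
      then show thesis using that[of x y 1] by (simp add: poly)
    qed
    then show "P \<in> cubic_model g" unfolding cubic_model_def hom by blast
  qed
qed

lemma card_cubic_model:
  fixes g :: "'a::{field,finite} poly"
  assumes deg: "degree g \<le> 3" and lead: "Polynomial.coeff g 3 \<noteq> 0"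
  shows "int (card (cubic_model g)) = int CARD('a) + 1 + (\<Sum>x\<in>UNIV. quad_char (poly g x))"
proof -
  let ?S = "SIGMA x:(UNIV::'a set). {y. y\<^sup>2 = poly g x}" and ?f = "\<lambda>(x, y). proj_point (vector [x, y, 1])"
  \<comment> \<open>The third coordinate on the left stays general so that z = 1 yields injectivity
    on the affine part and z = 0 shows that the point at infinity lies outside it.\<close>
  have eq: "proj_point (vector [x, y, z]) = proj_point (vector [x', y', 1]) \<Longrightarrow> z \<noteq> 0 \<and> x = x' * z \<and> y = y' * z"
    if "(x, y, z) \<noteq> (0, 0, 0)" for x y z x' y' :: 'a
  proof -
    assume "proj_point (vector [x, y, z]) = proj_point (vector [x', y', 1])"
    moreover have "vector [x, y, z] \<noteq> (0::'a ^ 3)" "vector [x', y', 1] \<noteq> (0::'a ^ 3)"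
      using that by (auto simp: vec_eq_iff forall_3)
    ultimately obtain c where "c \<noteq> 0" "vector [x', y', 1] = c *s (vector [x, y, z] :: 'a ^ 3)"
      using proj_point_eq_iff by blast
    then have "x' = c * x" "y' = c * y" "1 = c * z" by (simp_all add: vec_eq_iff forall_3)
    then show ?thesis by (simp add: mult_ac) (metis mult.left_commute mult.right_neutral mult_zero_right zero_neq_one)
  qed
  have "inj_on ?f ?S"
    using eq[of _ _ 1] by (auto simp: inj_on_def)
  moreover have "proj_point (vector [0, 1, 0]) \<notin> ?f ` ?S"
    using eq[of 0 1 0] by auto
  ultimately have "card (cubic_model g) = 1 + card ?S"
    unfolding cubic_model_eq[OF assms] by (simp add: card_image)
  also have "int \<dots> = 1 + (\<Sum>x\<in>(UNIV::'a set). int (card {y. y\<^sup>2 = poly g x}))"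
    by (simp add: card_SigmaI)
  finally show ?thesis
    by (simp add: quad_char_def sum_subtractf)
qed

lemma frobenius_trace_pencil_cubic:
  fixes C D :: "'a::{field,finite} ^ 3 ^ 3"
  assumes "det C \<noteq> 0" "det D \<noteq> 0"
  shows "frobenius_trace (pencil_cubic C D) = - (\<Sum>x\<in>UNIV. quad_char (det D * det (pencil C D x)))"
  unfolding frobenius_trace_def
  using card_cubic_model[OF degree_pencil_cubic_le, of C D] assms
  by (simp add: coeff_pencil_cubic_3 poly_pencil_cubic)

section \<open>The Frobenius map on lines\<close>

text \<open>Multiplication by a nonzero x permutes the nonzero elements; comparing their products
  before and after gives x^(q-1) = 1.\<close>

lemma power_card_eq_self:
  fixes x :: "'a::{field,finite}"
  shows "x ^ CARD('a) = x"
proof (cases "x = 0")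
  case False
  have "(\<Prod>y\<in>UNIV - {0}. y) = (\<Prod>y\<in>UNIV - {0}. x * y)"
    by (rule prod.reindex_bij_witness[of _ "\<lambda>y. x * y" "\<lambda>y. y / x"]) (use False in auto)
  also have "\<dots> = x ^ (CARD('a) - 1) * (\<Prod>y\<in>UNIV - {0}. y)"
    by (simp add: prod.distrib)
  finally have "x ^ (CARD('a) - 1) = 1"
    by (simp add: prod_zero_iff)
  then have "x * x ^ (CARD('a) - 1) = x" by simp
  then show ?thesis using zero_less_card_finite[where ?'a = 'a] by (simp flip: power_Suc)
qed simp

lemma poly_eq_0_if_vanishes_on_Fq:
  fixes p :: "'a::{field,finite} alg_closure poly"
  assumes "degree p < CARD('a)" "\<And>x::'a. poly p (to_ac x) = 0"
  shows "p = 0"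
proof (rule ccontr)
  assume "p \<noteq> 0"
  have "CARD('a) = card (range (to_ac :: 'a \<Rightarrow> _))"
    by (simp add: card_image inj_to_ac)
  also have "\<dots> \<le> card {x. poly p x = 0}"
    using assms(2) poly_roots_finite[OF \<open>p \<noteq> 0\<close>] by (intro card_mono) auto
  also have "\<dots> \<le> degree p"
    by (rule card_poly_roots_bound[OF \<open>p \<noteq> 0\<close>])
  finally show False using assms(1) by simp
qed

text \<open>The polynomial X^q - X has at most q roots, and the q elements of \<open>Fq\<close>
  already are roots.\<close>

lemma Fq_iff:
  fixes z :: "'a::{field,finite} alg_closure"
  shows "z \<in> Fq \<longleftrightarrow> z ^ CARD('a) = z"
proof
  assume "z \<in> Fq"
  then show "z ^ CARD('a) = z"
    unfolding Fq_def by (auto simp: power_card_eq_self simp flip: to_ac_power)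
next
  assume z: "z ^ CARD('a) = z"
  let ?p = "Polynomial.monom 1 CARD('a) - [:0, 1:] :: 'a alg_closure poly"
  have "Polynomial.coeff ?p CARD('a) = 1"
    using card_gt_1[where ?'a = 'a] by (simp add: coeff_pCons split: nat.splits)
  then have "?p \<noteq> 0" by (metis coeff_0 zero_neq_one)
  have deg: "degree ?p \<le> CARD('a)"
    using card_gt_1[where ?'a = 'a] by (intro degree_diff_le degree_monom_le) simp
  have fin: "finite {x. poly ?p x = 0}" by (rule poly_roots_finite[OF \<open>?p \<noteq> 0\<close>])
  have sub: "Fq \<subseteq> {x. poly ?p x = 0}"
    unfolding Fq_def by (auto simp: poly_monom power_card_eq_self simp flip: to_ac_power)
  have "card {x. poly ?p x = 0} \<le> card (Fq :: 'a alg_closure set)"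
    using card_poly_roots_bound[OF \<open>?p \<noteq> 0\<close>] deg by (simp add: Fq_def card_image inj_to_ac)
  then have "Fq = {x. poly ?p x = 0}"
    using card_seteq[OF fin sub] by simp
  moreover have "z \<in> {x. poly ?p x = 0}" using z by (simp add: poly_monom)
  ultimately show "z \<in> Fq" by blast
qed

text \<open>
  This avoids writing \<open>q\<close> as a power of the characteristic: the difference of the two sides is a
  polynomial of degree less than \<open>q\<close> in each variable, and it vanishes on \<open>F\<^sub>q \<times> F\<^sub>q\<close>.
\<close>

lemma frobenius_add:
  fixes x y :: "'a::{field,finite} alg_closure"
  shows "(x + y) ^ CARD('a) = x ^ CARD('a) + y ^ CARD('a)"
proof -
  let ?q = "CARD('a)"
  define p where "p s = [:s, 1:] ^ ?q - [:s ^ ?q:] - Polynomial.monom 1 ?q" for s :: "'a alg_closure"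
  have poly_p: "poly (p s) u = (s + u) ^ ?q - s ^ ?q - u ^ ?q" for s u
    by (simp add: p_def poly_monom)
  have deg: "degree (p s) < ?q" for s
  proof (rule degree_lessI)
    show "p s \<noteq> 0 \<or> ?q > 0" by simp
    show "\<forall>k\<ge>?q. Polynomial.coeff (p s) k = 0"
    proof (intro allI impI)
      fix k assume k: "k \<ge> ?q"
      have "Polynomial.coeff ([:s, 1:] ^ ?q) k = (if k = ?q then 1 else 0)"
      proof (cases "k = ?q")
        case True
        then show ?thesis
          using degree_linear_power[of s ?q] lead_coeff_power[of "[:s, 1:]" ?q] by simp
      next
        case False
        with k have "degree ([:s, 1:] ^ ?q) < k" by (simp add: degree_linear_power)
        then show ?thesis using False by (simp add: coeff_eq_0)
      qed
      moreover have "Polynomial.coeff [:s ^ ?q:] k = 0"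
        using k card_gt_1[where ?'a = 'a] by (simp add: coeff_pCons split: nat.splits)
      ultimately show "Polynomial.coeff (p s) k = 0" by (simp add: p_def)
    qed
  qed
  have Fq: "p (to_ac s) = 0" for s :: 'a
    using deg by (rule poly_eq_0_if_vanishes_on_Fq)
      (simp only: poly_p power_card_eq_self to_ac_0 flip: to_ac_power to_ac_add, simp)
  \<comment> \<open>The difference is symmetric in its two arguments: that \<open>p\<close> vanishes
    identically at parameters from F_q also says that \<open>p x\<close> vanishes on F_q for
    arbitrary \<open>x\<close>.\<close>
  have "poly (p x) (to_ac s) = 0" for s :: 'a
    using arg_cong[OF Fq[of s], of "\<lambda>r. poly r x"] by (simp add: poly_p algebra_simps)
  then have "p x = 0" using deg by (intro poly_eq_0_if_vanishes_on_Fq)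
  then have "poly (p x) y = 0" by simp
  then show ?thesis by (simp add: poly_p algebra_simps)
qed

lemma frob_vec_nth [simp]: "frob_vec v $ i = (v $ i) ^ CARD('a)"
  for v :: "'a::{field,finite} alg_closure ^ 3"
  by (simp add: frob_vec_def)

text \<open>Additivity of the q-power map turns a . v = 0 into the same equation for the conjugated
  vectors. Equality, rather than inclusion, requires every vector to be a conjugate, which follows
  from the existence of q-th roots in the algebraic closure.\<close>

lemma frob_line_proj_line:
  fixes a :: "'a::{field,finite} alg_closure ^ 3"
  shows "frob_line (proj_line a) = proj_line (frob_vec a)"
proof -
  have surj: "\<exists>c. c ^ CARD('a) = d" for d :: "'a alg_closure"
    using nth_root_exists[of "CARD('a)" d] by auto
  have surj_vec: "\<exists>v. frob_vec v = w" for w :: "'a alg_closure ^ 3"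
  proof -
    have "frob_vec (\<chi> i. SOME c. c ^ CARD('a) = w $ i) = w"
      using someI_ex[OF surj] by (simp add: vec_eq_iff)
    then show ?thesis ..
  qed
  have frob_smult: "frob_vec (c *s v) = c ^ CARD('a) *s frob_vec v" for c and v :: "'a alg_closure ^ 3"
    by (simp add: vec_eq_iff power_mult_distrib)
  have point: "frob_vec ` proj_point v = proj_point (frob_vec v)" for v :: "'a alg_closure ^ 3"
  proof (intro equalityI subsetI)
    fix w assume "w \<in> proj_point (frob_vec v)"
    then obtain d where "w = d *s frob_vec v" unfolding proj_point_def by blast
    with surj[of d] obtain c where "w = frob_vec (c *s v)" by (metis frob_smult)
    then show "w \<in> frob_vec ` proj_point v" unfolding proj_point_def by blast
  qed (auto simp: proj_point_def frob_smult)
  have sp: "scalar_product (frob_vec a) (frob_vec v) = (scalar_product a v) ^ CARD('a)" for v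
    by (simp add: scalar_product_def sum_3 frobenius_add power_mult_distrib)
  have nz: "frob_vec v = 0 \<longleftrightarrow> v = 0" for v :: "'a alg_closure ^ 3"
    by (simp add: vec_eq_iff)
  show ?thesis
  proof (intro equalityI subsetI)
    fix P assume "P \<in> frob_line (proj_line a)"
    then obtain v where "v \<noteq> 0" "scalar_product a v = 0" "P = proj_point (frob_vec v)"
      unfolding frob_line_def proj_line_def by (auto simp: point)
    then show "P \<in> proj_line (frob_vec a)"
      unfolding proj_line_def using sp[of v] nz[of v] by auto
  next
    fix P assume "P \<in> proj_line (frob_vec a)"
    then obtain w where w: "w \<noteq> 0" "scalar_product (frob_vec a) w = 0" "P = proj_point w"
      unfolding proj_line_def by blast
    obtain v where v: "w = frob_vec v" using surj_vec by metis
    then have "v \<noteq> 0" "scalar_product a v = 0" using w sp[of v] nz[of v] by auto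
    then have "proj_point v \<in> proj_line a" unfolding proj_line_def by blast
    then show "P \<in> frob_line (proj_line a)"
      unfolding frob_line_def using point[of v] v w by auto
  qed
qed

section \<open>Coordinate vectors of lines and base change\<close>

lemma scalar_product_smult_left: "scalar_product (c *s a) v = c * scalar_product a v"
  for a v :: "'k::field ^ 3"
  by (simp add: scalar_product_def sum_3 algebra_simps)

lemma scalar_product_smult_right: "scalar_product a (c *s v) = c * scalar_product a v"
  for a v :: "'k::field ^ 3"
  by (simp add: scalar_product_def sum_3 algebra_simps)

lemma proj_line_smult:
  fixes a :: "'k::field ^ 3"
  assumes "c \<noteq> 0"
  shows "proj_line (c *s a) = proj_line a"
  using assms by (simp add: proj_line_def scalar_product_smult_left)

lemma proj_point_in_proj_line:
  fixes a v :: "'k::field ^ 3"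
  assumes "v \<noteq> 0"
  shows "proj_point v \<in> proj_line a \<longleftrightarrow> scalar_product a v = 0"
proof
  assume "proj_point v \<in> proj_line a"
  then obtain w where w: "w \<noteq> 0" "scalar_product a w = 0" "proj_point w = proj_point v"
    unfolding proj_line_def by auto
  then obtain c where "v = c *s w" using proj_point_eq_iff[OF w(1) assms] by auto
  with w show "scalar_product a v = 0" by (simp add: scalar_product_smult_right)
qed (use assms in \<open>auto simp: proj_line_def\<close>)

lemma proj_line_eqD:
  fixes a b :: "'k::field ^ 3"
  assumes "proj_line a = proj_line b" "a \<noteq> 0"
  obtains c where "b = c *s a"
proof -
  have orth: "scalar_product b v = 0" if "scalar_product a v = 0" for v
  proof (cases "v = 0")
    case False
    then show ?thesis using that assms(1) proj_point_in_proj_line[OF False] by metis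
  qed (simp add: scalar_product_def)
  obtain i where i: "a $ i \<noteq> 0" using assms(2) by (metis vec_eq_iff zero_index)
  have "b $ i * a $ j = a $ i * b $ j" for j
  proof -
    \<comment> \<open>These vectors are orthogonal to \<open>a\<close>, hence to \<open>b\<close>,
      and their scalar products with \<open>b\<close> are the minors of the pair (a, b) that involve
      the pivot index \<open>i\<close>.\<close>
    let ?v = "a $ j *s axis i 1 - a $ i *s axis j 1 :: 'k ^ 3"
    have "scalar_product u ?v = u $ i * a $ j - a $ i * u $ j" for u :: "'k ^ 3"
      using exhaust_3[of i] exhaust_3[of j]
      by (elim disjE) (simp_all add: scalar_product_def sum_3 axis_def)
    then show ?thesis using orth[of ?v] by simp
  qed
  then have "b = (b $ i / a $ i) *s a"
    using i by (simp add: vec_eq_iff field_simps)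
  then show ?thesis by (rule that)
qed

lemma vec_ac_nth [simp]: "vec_ac v $ i = to_ac (v $ i)"
  for v :: "'a::field ^ 3"
  by (simp add: vec_ac_def)

lemma mat_ac_nth [simp]: "mat_ac A $ i $ j = to_ac (A $ i $ j)"
  for A :: "'a::field ^ 3 ^ 3"
  by (simp add: mat_ac_def map_matrix_def)

lemma mat_ac_mult: "mat_ac (A ** B) = mat_ac A ** mat_ac B"
  for A B :: "'a::field ^ 3 ^ 3"
  by (simp add: vec_eq_iff matrix_matrix_mult_def to_ac_sum)

lemma mat_ac_mult_vec_ac: "mat_ac A *v vec_ac v = vec_ac (A *v v)"
  for A :: "'a::field ^ 3 ^ 3"
  by (simp add: vec_eq_iff matrix_vector_mult_def to_ac_sum)

lemma mat_ac_transpose: "mat_ac (transpose A) = transpose (mat_ac A)"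
  for A :: "'a::field ^ 3 ^ 3"
  by (simp add: vec_eq_iff transpose_def)

lemma mat_ac_diag3: "mat_ac (diag3 a b c) = diag3 (to_ac a) (to_ac b) (to_ac c)"
  for a :: "'a::field"
  by (simp add: vec_eq_iff forall_3 diag3_def)

lemma conic_gradient_symmetric:
  fixes A :: "'k::field ^ 3 ^ 3"
  assumes "transpose A = A"
  shows "conic_gradient A v = 2 *s (A *v v)"
  unfolding conic_gradient_def assms matrix_vector_mult_add_rdistrib
  by (simp only: vec_eq_iff vector_add_component vector_smult_component mult_2 simp_thms)

section \<open>Tangent lines\<close>

lemma scalar_product_sym: "scalar_product u v = scalar_product v u"
  for u v :: "'k::field ^ 3"
  by (simp add: scalar_product_def mult.commute)

lemma vector_matrix_smult: "(c *s u) v* M = c *s (u v* M)"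
  for M :: "'k::field ^ 3 ^ 3"
  by (simp add: vector_matrix_mult_def vec_eq_iff sum_3 algebra_simps)

lemma diag3_mult_vector: "diag3 a b c *v u = vector [a * u $ 1, b * u $ 2, c * u $ 3]"
  for u :: "'k::field ^ 3"
  by (simp add: diag3_def matrix_vector_mult_def vec_eq_iff forall_3 sum_3)

text \<open>In the coordinates u given by the rows of \<open>M\<close> the point is (1, 0, 0), and
  the tangent at u contains it iff u_1 = 0, as the form is diagonal. The point of contact then
  satisfies b u_2^2 + e u_3^2 = 0 with u_3 nonzero, so up to scale it is (0, r, 1) or (0, -r, 1).
  The general field allows use over the algebraic closure, with everything but \<open>r\<close>
  coming from the ground field.\<close>

lemma tangent_lines_diagonal:
  fixes D M :: "'k::field ^ 3 ^ 3"
  assumes 2: "(2::'k) \<noteq> 0" and sym: "transpose D = D" and M: "det M \<noteq> 0"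
    and gram: "M ** D ** transpose M = diag3 a b e"
    and abe: "a \<noteq> 0" "b \<noteq> 0" "e \<noteq> 0" and r: "b * r\<^sup>2 + e = 0"
  shows "tangent_lines_through D (proj_point (M $ 1)) =
    {proj_line (D *v (vector [0, r, 1] v* M)), proj_line (D *v (vector [0, - r, 1] v* M))}"
proof -
  have grad: "proj_line (conic_gradient D w) = proj_line (D *v w)" for w
    unfolding conic_gradient_symmetric[OF sym] by (rule proj_line_smult[OF 2])
  have "quad_form D (M $ 1) = a"
    using gram_entry[of M D 1 1] by (simp add: gram diag3_def quad_form_def)
  then have M1: "M $ 1 \<noteq> 0" using abe(1) by auto
  have form: "quad_form D (u v* M) = a * (u $ 1)\<^sup>2 + b * (u $ 2)\<^sup>2 + e * (u $ 3)\<^sup>2" for u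
    using quad_form_transform[of M D u] by (simp add: gram quad_form_diag3)
  have inc: "proj_point (M $ 1) \<in> proj_line (D *v (u v* M)) \<longleftrightarrow> u $ 1 = 0" for u
  proof -
    have "scalar_product (D *v (u v* M)) (M $ 1) = (M *v (D *v (u v* M))) $ 1"
      by (subst scalar_product_sym) (simp add: matrix_vector_mult_def scalar_product_def)
    also have "\<dots> = a * u $ 1"
      unfolding gram_mult_vector[symmetric] gram diag3_mult_vector by simp
    finally show ?thesis using proj_point_in_proj_line[OF M1] abe(1) by simp
  qed
  have nz: "u v* M = 0 \<longleftrightarrow> u = 0" for u
  proof -
    have "0 v* M = 0" by (simp add: vector_matrix_mult_def vec_eq_iff)
    then show ?thesis using injD[OF bij_is_inj[OF bij_vector_matrix_mult[OF M]], of u 0] by auto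
  qed
  show ?thesis
  proof (intro equalityI subsetI)
    fix L assume "L \<in> tangent_lines_through D (proj_point (M $ 1))"
    then obtain w where w: "w \<noteq> 0" "quad_form D w = 0" "proj_point (M $ 1) \<in> proj_line (D *v w)"
      and L: "L = proj_line (D *v w)"
      unfolding tangent_lines_through_def grad by blast
    obtain u where u: "w = u v* M" using surjD[OF bij_is_surj[OF bij_vector_matrix_mult[OF M]], of w] by blast
    have u1: "u $ 1 = 0" using w(3) by (simp add: u inc)
    have eq: "b * (u $ 2)\<^sup>2 + e * (u $ 3)\<^sup>2 = 0" using w(2) by (simp add: u form u1)
    have u3: "u $ 3 \<noteq> 0"
    proof
      assume "u $ 3 = 0"
      with eq abe have "u = 0" by (simp add: vec_eq_iff forall_3 u1)
      with w(1) u show False by simp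
    qed
    have "b * (u $ 2)\<^sup>2 = b * (r * u $ 3)\<^sup>2"
    proof -
      have "e = - (b * r\<^sup>2)" using r by (simp add: eq_neg_iff_add_eq_0 add.commute)
      with eq show ?thesis by (simp add: power_mult_distrib mult_ac)
    qed
    then have "u $ 2 = r * u $ 3 \<or> u $ 2 = - r * u $ 3"
      using abe(2) by (simp add: power2_eq_iff)
    then obtain s where s1: "s = r \<or> s = - r" "u $ 2 = s * u $ 3" by blast
    then have s: "s = r \<or> s = - r" "u = u $ 3 *s vector [0, s, 1]"
      using u1 by (simp_all add: vec_eq_iff forall_3 mult.commute)
    have "L = proj_line (u $ 3 *s (D *v (vector [0, s, 1] v* M)))"
      unfolding L u by (subst s(2)) (simp only: vector_matrix_smult vector_scalar_commute)
    then show "L \<in> {proj_line (D *v (vector [0, r, 1] v* M)), proj_line (D *v (vector [0, - r, 1] v* M))}"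
      using s(1) by (auto simp: proj_line_smult[OF u3])
  next
    fix L assume "L \<in> {proj_line (D *v (vector [0, r, 1] v* M)), proj_line (D *v (vector [0, - r, 1] v* M))}"
    then obtain s where s: "s\<^sup>2 = r\<^sup>2" and L: "L = proj_line (D *v (vector [0, s, 1] v* M))"
      by (metis insertE power2_minus singletonD)
    have "vector [0, s, 1] \<noteq> (0 :: 'k ^ 3)" by (simp add: vec_eq_iff forall_3)
    then have "vector [0, s, 1] v* M \<noteq> 0" by (simp add: nz)
    moreover have "quad_form D (vector [0, s, 1] v* M) = 0" using r s by (simp add: form)
    moreover have "proj_point (M $ 1) \<in> proj_line (D *v (vector [0, s, 1] v* M))" by (simp add: inc)
    ultimately show "L \<in> tangent_lines_through D (proj_point (M $ 1))"
      unfolding tangent_lines_through_def grad L by blast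
  qed
qed

lemma mat_ac_vector_mult: "vec_ac u v* mat_ac M = vec_ac (u v* M)"
  for M :: "'a::field ^ 3 ^ 3"
  by (simp add: vec_eq_iff vector_matrix_mult_def to_ac_sum)

text \<open>Since \<open>M\<close> and \<open>e\<close> are rational, everything depends on a square
  root r of -e/b in the closure: either r lies in F_q and both tangents are rational, or Frobenius
  exchanges r and -r and with them the tangents. The characters agree because det D is a b e up to
  squares and -a (a b e) = (a b)^2 (-e / b).\<close>

lemma external_internal_point:
  fixes D :: "'a::{field,finite} ^ 3 ^ 3"
  assumes 2: "(2::'a) \<noteq> 0" and sym: "transpose D = D" and det: "det D \<noteq> 0"
    and v: "quad_form D v \<noteq> 0"
  shows "external_point D (proj_point v) \<longleftrightarrow> quad_char (- det D * quad_form D v) = 1"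
    and "internal_point D (proj_point v) \<longleftrightarrow> quad_char (- det D * quad_form D v) = -1"
proof -
  obtain w where w: "bilin D v w = 0" "quad_form D w \<noteq> 0"
    by (rule exists_orthogonal_vector[OF sym 2 det v])
  obtain M e where M: "det M \<noteq> 0" "M $ 1 = v"
      "M ** D ** transpose M = diag3 (quad_form D v) (quad_form D w) e"
    by (rule diagonalise[OF sym w(1) v w(2)])
  define a b where "a = quad_form D v" and "b = quad_form D w"
  note gram = M(3)[folded a_def b_def]
  have ab: "a \<noteq> 0" "b \<noteq> 0" using v w by (simp_all add: a_def b_def)
  have e: "e \<noteq> 0"
    using arg_cong[OF gram, of det] M(1) det by (auto simp: det_diag3 det_mul det_transpose)
  define Dk Mk where "Dk = mat_ac D" and "Mk = mat_ac M"
  have 2: "(2::'a alg_closure) \<noteq> 0" using 2 by (metis to_ac_eq_0_iff to_ac_numeral)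
  have symk: "transpose Dk = Dk" by (simp add: Dk_def sym flip: mat_ac_transpose)
  have gramk: "Mk ** Dk ** transpose Mk = diag3 (to_ac a) (to_ac b) (to_ac e)"
    unfolding Mk_def Dk_def mat_ac_mult[symmetric] mat_ac_transpose[symmetric] gram mat_ac_diag3 ..
  have detk: "det Mk \<noteq> 0" using M(1) by (simp add: Mk_def det_mat_ac)
  obtain r where r: "r\<^sup>2 = to_ac (- e / b)" using nth_root_exists[of 2 "to_ac (- e / b)"] by auto
  have abek: "to_ac a \<noteq> 0" "to_ac b \<noteq> 0" "to_ac e \<noteq> 0" using ab e by simp_all
  have r_eq: "to_ac b * r\<^sup>2 + to_ac e = 0" unfolding r using ab by simp
  have "r \<noteq> 0" using r e ab by auto
  then have r_neg: "r \<noteq> - r" by (rule neg_neq_self[OF 2])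

  define g where "g s = Dk *v (vector [0, s, 1] v* Mk)" for s
  \<comment> \<open>The rational invertible matrix \<open>Mk\<close> brings the line coordinates
    into a shape from which s can be read off: the last entry is nonzero and independent of
    s.\<close>
  have act: "Mk *v g s = vector [0, to_ac b * s, to_ac e]" for s
    unfolding g_def gram_mult_vector[symmetric] gramk diag3_mult_vector by simp
  have g_nz: "g s \<noteq> 0" for s
  proof
    assume "g s = 0"
    then have "(Mk *v g s) $ 3 = 0" by simp
    then show False using e by (simp add: act)
  qed
  have point: "ppoint_ac (proj_point v) = proj_point (Mk $ 1)"
  proof -
    have "vec_ac (M $ 1) = mat_ac M $ 1" by (simp add: vec_eq_iff)
    then show ?thesis unfolding ppoint_ac_proj_point M(2)[symmetric] Mk_def by simp
  qed
  have tangents: "tangent_lines_through Dk (ppoint_ac (proj_point v)) = {proj_line (g r), proj_line (g (- r))}"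
    unfolding point g_def
    by (rule tangent_lines_diagonal[OF 2 symk detk gramk abek r_eq])
  have g_multiple: "t = s" if "g t = c *s g s" for s t c
  proof -
    have "Mk *v g t = c *s (Mk *v g s)" by (simp add: that vector_scalar_commute)
    then have "to_ac b * t = c * (to_ac b * s)" "to_ac e = c * to_ac e"
      by (simp_all add: act vec_eq_iff forall_3)
    then show ?thesis using e ab by simp
  qed
  have distinct: "proj_line (g r) \<noteq> proj_line (g (- r))"
  proof
    assume "proj_line (g r) = proj_line (g (- r))"
    then obtain c where "g (- r) = c *s g r" by (rule proj_line_eqD[OF _ g_nz])
    then show False using g_multiple r_neg by fastforce
  qed
  have g_ac: "g (to_ac s) = vec_ac (D *v (vector [0, s, 1] v* M))" for s
  proof -
    have "vector [0, to_ac s, 1] = vec_ac (vector [0, s, 1] :: 'a ^ 3)"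
      by (simp add: vec_eq_iff forall_3)
    then show ?thesis by (simp add: g_def Dk_def Mk_def mat_ac_vector_mult mat_ac_mult_vec_ac)
  qed
  have rational: "line_defined_over Fq (proj_line (g s))" if s: "s \<in> Fq" for s
  proof -
    obtain s' where "s = to_ac s'" using s unfolding Fq_def by blast
    then show ?thesis unfolding line_defined_over_def
      by (intro exI[of _ "g s"]) (simp add: g_nz, simp add: g_ac Fq_def)
  qed
  \<comment> \<open>A rational coordinate vector of the line may be a multiple of \<open>g s\<close>
    by a scalar c outside F_q. Applying the rational matrix gives (0, c b s, c e), and in the ratio
    of the last two entries c drops out.\<close>
  have irrational: "s \<in> Fq" if s: "line_defined_over Fq (proj_line (g s))" for s
  proof -
    obtain k where k: "k \<noteq> 0" "\<And>i. k $ i \<in> Fq" "proj_line (g s) = proj_line k"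
      using s unfolding line_defined_over_def by blast
    obtain c where c: "k = c *s g s" by (rule proj_line_eqD[OF k(3) g_nz])
    then have c0: "c \<noteq> 0" using k(1) by auto
    define l where "l = (\<chi> i. of_ac (k $ i))"
    have "vec_ac l = k"
      using k(2) by (simp add: l_def vec_eq_iff to_ac_of_ac Fq_def)
    then have "vec_ac (M *v l) = c *s (Mk *v g s)"
      unfolding mat_ac_mult_vec_ac[symmetric] Mk_def[symmetric] by (simp add: c vector_scalar_commute)
    then obtain m where "vec_ac m = c *s (Mk *v g s)" by blast
    then have "to_ac (m $ 2) = c * (to_ac b * s)" "to_ac (m $ 3) = c * to_ac e"
      by (simp_all add: act vec_eq_iff forall_3)
    then have "s = to_ac (m $ 2 * e / (m $ 3 * b))"
      using c0 e ab by (simp add: field_simps)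
    then show ?thesis unfolding Fq_def by (rule range_eqI)
  qed

  have "quad_char (- det D * a) = quad_char (- a * (a * b * e))"
    using quad_char_det_diagonal[OF M(1) gram, of "- a"] by (simp add: mult.commute)
  also have "- a * (a * b * e) = (a * b)\<^sup>2 * (- e / b)"
    using ab by (simp add: power2_eq_square field_simps)
  also have "quad_char \<dots> = quad_char (- e / b)"
    using ab by (intro quad_char_mult_square) simp
  finally have char: "quad_char (- det D * quad_form D v) = quad_char (- e / b)"
    by (simp add: a_def)
  have not_D: "proj_point v \<notin> conic D"
    using v by (subst proj_point_in_conic) auto
  have eb: "- e / b \<noteq> 0" using e ab by simp
  consider s where "- e / b = s\<^sup>2" "quad_char (- e / b) = 1"
    | "\<nexists>s. s\<^sup>2 = - e / b" "quad_char (- e / b) = -1"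
    by (rule quad_char_cases[OF assms(1), of "- e / b"]) (use eb in auto)
  then have "(external_point D (proj_point v) \<longleftrightarrow> quad_char (- det D * quad_form D v) = 1) \<and>
    (internal_point D (proj_point v) \<longleftrightarrow> quad_char (- det D * quad_form D v) = -1)"
  proof cases
    case 1
    then have "r\<^sup>2 = (to_ac s)\<^sup>2" using r by simp
    then have "r = to_ac s \<or> r = to_ac (- s)" by (simp add: power2_eq_iff)
    then have "r \<in> Fq" "- r \<in> Fq" unfolding Fq_def by (auto simp flip: to_ac_minus)
    then have *: "line_defined_over Fq (proj_line (g r))" "line_defined_over Fq (proj_line (g (- r)))"
      using rational by blast+
    have "external_point D (proj_point v)"
      unfolding external_point_def
      by (intro conjI exI) (fact not_D distinct tangents[unfolded Dk_def] *)+
    moreover have "\<not> internal_point D (proj_point v)"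
    proof
      assume "internal_point D (proj_point v)"
      then obtain L where "L \<in> {proj_line (g r), proj_line (g (- r))}" "\<not> line_defined_over Fq L"
        unfolding internal_point_def tangents[unfolded Dk_def] by (metis insertI1)
      with * show False by blast
    qed
    ultimately show ?thesis using char 1 by simp
  next
    case 2
    have r_Fq: "r \<notin> Fq"
    proof
      assume "r \<in> Fq"
      then obtain s where "r = to_ac s" unfolding Fq_def by blast
      with r have "to_ac (s\<^sup>2) = to_ac (- e / b)" by simp
      then have "s\<^sup>2 = - e / b" by (simp only: to_ac_eq_iff)
      with 2 show False by blast
    qed
    moreover have "- r \<notin> Fq"
    proof
      assume "- r \<in> Fq"
      then obtain s where "- r = to_ac s" unfolding Fq_def by blast
      then have "r = to_ac (- s)" by (simp add: minus_equation_iff eq_commute)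
      with r_Fq show False unfolding Fq_def by blast
    qed
    ultimately have *: "\<not> line_defined_over Fq (proj_line (g r))" "\<not> line_defined_over Fq (proj_line (g (- r)))"
      using irrational by blast+
    \<comment> \<open>As r^2 is rational, r^q is again a square root of it; r^q = r is excluded
      because r is not in F_q.\<close>
    have "(r ^ CARD('a))\<^sup>2 = (r\<^sup>2) ^ CARD('a)" by (simp add: mult.commute flip: power_mult)
    also have "\<dots> = r\<^sup>2" unfolding r by (simp only: power_card_eq_self flip: to_ac_power)
    finally have "r ^ CARD('a) = r \<or> r ^ CARD('a) = - r" by (simp add: power2_eq_iff)
    then have frob_r: "r ^ CARD('a) = - r" using r_Fq Fq_iff by blast
    \<comment> \<open>For even q the sign would be lost in (-r)^q = r^q = -r, which would put -r
      into F_q.\<close>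
    have "odd CARD('a)"
    proof
      assume "even CARD('a)"
      then have "(- r) ^ CARD('a) = - r" using frob_r by simp
      with \<open>- r \<notin> Fq\<close> show False using Fq_iff by blast
    qed
    then have frob_neg_r: "(- r) ^ CARD('a) = r" by (simp add: frob_r)
    \<comment> \<open>The line coordinates are affine in s with rational coefficients, so Frobenius
      acts on them through s alone.\<close>
    have coord: "g s $ i = to_ac ((D *v (M $ 3)) $ i) + to_ac ((D *v (M $ 2)) $ i) * s" for s i
      by (simp add: g_def Dk_def Mk_def matrix_vector_mult_def vector_matrix_mult_def sum_3 algebra_simps)
    have frob_g: "frob_vec (g s) = g (s ^ CARD('a))" for s
      by (simp add: vec_eq_iff coord frobenius_add power_mult_distrib power_card_eq_self flip: to_ac_power)
    then have frob: "proj_line (g (- r)) = frob_line (proj_line (g r))"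
      by (simp add: frob_line_proj_line frob_r)
    have Fq2: "line_defined_over Fq2 (proj_line (g s))" if "s = r \<or> s = - r" for s
    proof -
      have "frob_vec (frob_vec (g s)) = g s"
        using that by (auto simp: frob_g frob_r frob_neg_r)
      then have "(g s $ i ^ CARD('a)) ^ CARD('a) = g s $ i" for i
        by (metis frob_vec_nth)
      then have "g s $ i \<in> Fq2" for i
        by (simp add: Fq2_def power2_eq_square power_mult)
      then show ?thesis unfolding line_defined_over_def using g_nz by blast
    qed
    have "internal_point D (proj_point v)"
      unfolding internal_point_def
      by (intro conjI exI) (fact not_D distinct tangents[unfolded Dk_def] * frob Fq2[of r, simplified] Fq2[of "- r", simplified])+
    moreover have "\<not> external_point D (proj_point v)"
    proof
      assume "external_point D (proj_point v)"
      then obtain L where "L \<in> {proj_line (g r), proj_line (g (- r))}" "line_defined_over Fq L"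
        unfolding external_point_def tangents[unfolded Dk_def] by (metis insertI1)
      with * show False by blast
    qed
    ultimately show ?thesis using char 2 by simp
  qed
  then show "external_point D (proj_point v) \<longleftrightarrow> quad_char (- det D * quad_form D v) = 1"
    and "internal_point D (proj_point v) \<longleftrightarrow> quad_char (- det D * quad_form D v) = -1" by auto
qed

section \<open>Members of a transverse pencil have rank at least two\<close>

text \<open>Over a finite field the product of all X - a, increased by 1, takes the value 1
  everywhere and so has no root, although its degree is positive.\<close>

lemma infinite_alg_closed: "infinite (UNIV :: 'k::alg_closed_field set)"
proof
  assume fin: "finite (UNIV :: 'k set)"
  let ?p = "(\<Prod>a\<in>(UNIV :: 'k set). [:- a, 1:]) + [:1:]"
  have "degree (\<Prod>a\<in>(UNIV :: 'k set). [:- a, 1:]) = card (UNIV :: 'k set)"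
    by (subst degree_prod_eq_sum_degree) simp_all
  moreover have "card (UNIV :: 'k set) > 0" using fin by (simp add: card_gt_0_iff)
  ultimately have "degree ?p > 0" by (subst degree_add_eq_left) simp_all
  then obtain x where "poly ?p x = 0" using alg_closed_imp_poly_has_root by blast
  moreover have "(\<Prod>a\<in>(UNIV :: 'k set). x - a) = 0"
    using fin by (auto simp: prod_zero_iff)
  ultimately show False by (simp add: poly_prod)
qed


text \<open>After diagonalisation, each t yields a point (t, y, 1), where b y^2 = -(a t^2 + e) is
  solved by a square root. The normalised last coordinate keeps points for different t
  distinct.\<close>

lemma infinite_conic:
  fixes A :: "'k::alg_closed_field ^ 3 ^ 3"
  assumes 2: "(2::'k) \<noteq> 0" and sym: "transpose A = A" and det: "det A \<noteq> 0"
  shows "infinite (conic A)"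
proof -
  have "\<not> rank_le_1 A" using det det_eq_0_if_rank_le_1 by blast
  from exists_orthogonal_pair[OF sym 2 this]
  obtain v w where vw: "bilin A v w = 0" "quad_form A v \<noteq> 0" "quad_form A w \<noteq> 0" by blast
  obtain M e where M: "det M \<noteq> 0" "M $ 1 = v"
      "M ** A ** transpose M = diag3 (quad_form A v) (quad_form A w) e"
    by (rule diagonalise[OF sym vw])
  define a b where "a = quad_form A v" and "b = quad_form A w"
  have b: "b \<noteq> 0" using vw by (simp add: b_def)
  have form: "quad_form A (u v* M) = a * (u $ 1)\<^sup>2 + b * (u $ 2)\<^sup>2 + e * (u $ 3)\<^sup>2" for u
    using quad_form_transform[of M A u] by (simp add: M(3) quad_form_diag3 a_def b_def)
  have inj: "inj (\<lambda>u. u v* M)" using bij_vector_matrix_mult[OF M(1)] by (rule bij_is_inj)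
  have "\<exists>y. y\<^sup>2 = - (a * t\<^sup>2 + e) / b" for t by (rule nth_root_exists) simp
  then obtain y where y: "\<And>t. (y t)\<^sup>2 = - (a * t\<^sup>2 + e) / b" by metis
  define f where "f t = vector [t, y t, 1] v* M" for t
  have nz: "f t \<noteq> 0" for t
  proof
    assume "f t = 0"
    then have "vector [t, y t, 1] v* M = 0 v* M"
      by (simp add: f_def vector_matrix_mult_def vec_eq_iff)
    then have "vector [t, y t, 1] = (0 :: 'k ^ 3)" by (rule injD[OF inj])
    then show False by (simp add: vec_eq_iff forall_3)
  qed
  have "quad_form A (f t) = 0" for t using b by (simp add: f_def form y)
  then have "range (\<lambda>t. proj_point (f t)) \<subseteq> conic A"
    using nz unfolding conic_def by blast
  moreover have "inj (\<lambda>t. proj_point (f t))"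
  proof (rule injI)
    fix s t assume "proj_point (f s) = proj_point (f t)"
    then obtain c where "f t = c *s f s" using proj_point_eq_iff[OF nz nz] by blast
    then have "vector [t, y t, 1] v* M = (c *s vector [s, y s, 1]) v* M"
      by (simp add: f_def vector_matrix_mult_def vec_eq_iff sum_3 algebra_simps)
    then have "vector [t, y t, 1] = c *s (vector [s, y s, 1] :: 'k ^ 3)" by (rule injD[OF inj])
    then show "s = t" by (simp add: vec_eq_iff forall_3)
  qed
  ultimately show ?thesis
    using infinite_alg_closed finite_imageD finite_subset by (metis inj_on_def)
qed

section \<open>A line meets a smooth conic in at most two points\<close>

lemma row_combination:
  fixes u v w :: "'k::field ^ 3"
  assumes "det (vector [u, v, w] :: 'k ^ 3 ^ 3) = 0"
  obtains x y z where "(x, y, z) \<noteq> (0, 0, 0)" "x *s u + y *s v + z *s w = 0"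
proof -
  let ?M = "vector [u, v, w] :: 'k ^ 3 ^ 3"
  have "\<not> invertible (transpose ?M)" using assms by (simp add: invertible_det_nz det_transpose)
  then obtain k where k: "transpose ?M *v k = 0" "k \<noteq> 0"
    using matrix_left_invertible_ker[of "transpose ?M"] invertible_left_inverse[of "transpose ?M"] by blast
  have "(k $ 1, k $ 2, k $ 3) \<noteq> (0, 0, 0)" using k(2) by (simp add: vec_eq_iff forall_3)
  moreover have "k $ 1 *s u + k $ 2 *s v + k $ 3 *s w = 0"
    using k(1) by (simp add: vec_eq_iff forall_3 vector_matrix_mult_def sum_3 mult.commute)
  ultimately show ?thesis by (rule that)
qed

text \<open>Completing u, v to a basis by w gives a Gram matrix with a zero block of size two by
  two, which is singular in dimension three. If no w existed, the choices w =
  \<open>axis i 1\<close> would make all minors of u, v vanish and u a multiple of v.\<close>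

lemma isotropic_plane_det_eq_0:
  fixes A :: "'k::field ^ 3 ^ 3"
  assumes sym: "transpose A = A" and u: "quad_form A u = 0" and v: "quad_form A v = 0" and uv: "bilin A u v = 0"
    and indep: "\<And>c. u \<noteq> c *s v" "v \<noteq> 0"
  shows "det A = 0"
proof -
  have "\<exists>w. det (vector [w, u, v] :: 'k ^ 3 ^ 3) \<noteq> 0"
  proof (rule ccontr)
    assume "\<nexists>w. det (vector [w, u, v] :: 'k ^ 3 ^ 3) \<noteq> 0"
    then have *: "det (vector [axis i 1, u, v] :: 'k ^ 3 ^ 3) = 0" for i by blast
    have m: "u $ i * v $ j = u $ j * v $ i" for i j
      using *[of 1] *[of 2] *[of 3] exhaust_3[of i] exhaust_3[of j]
      by (elim disjE) (simp_all add: det_3 axis_def)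
    obtain j where j: "v $ j \<noteq> 0" using indep(2) by (auto simp: vec_eq_iff)
    have "u = (u $ j / v $ j) *s v"
      using j m by (simp add: vec_eq_iff field_simps)
    with indep(1) show False by blast
  qed
  then obtain w where w: "det (vector [w, u, v] :: 'k ^ 3 ^ 3) \<noteq> 0" by blast
  let ?M = "vector [w, u, v] :: 'k ^ 3 ^ 3"
  have "bilin A v u = 0" using uv bilin_sym[OF sym] by metis
  then have "det (?M ** A ** transpose ?M) = 0"
    using u v uv by (simp add: det_3 gram_entry quad_form_def)
  then show ?thesis using w by (simp add: det_mul det_transpose)
qed

text \<open>Three vectors orthogonal to a nonzero \<open>l\<close> satisfy a relation x u + y v = -z
  w, with x and y nonzero by pairwise independence. Evaluating the form on both sides leaves 2 x y
  B(u, v) = 0, with B the bilinear form of A. So u and v span a totally isotropic plane, against det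
  A being nonzero.\<close>

lemma line_meets_conic_in_two_points:
  fixes A :: "'k::field ^ 3 ^ 3"
  assumes 2: "(2::'k) \<noteq> 0" and sym: "transpose A = A" and det: "det A \<noteq> 0" and l: "l \<noteq> 0"
    and u: "u \<noteq> 0" "quad_form A u = 0" "scalar_product l u = 0"
    and v: "v \<noteq> 0" "quad_form A v = 0" "scalar_product l v = 0"
    and w: "w \<noteq> 0" "quad_form A w = 0" "scalar_product l w = 0"
    and uv: "\<And>c. u \<noteq> c *s v" and uw: "\<And>c. u \<noteq> c *s w" and vw: "\<And>c. v \<noteq> c *s w"
  shows False
proof -
  let ?M = "vector [u, v, w] :: 'k ^ 3 ^ 3"
  have "?M *v l = 0"
    using u(3) v(3) w(3)
    by (simp add: vec_eq_iff forall_3 matrix_vector_mult_def scalar_product_def mult.commute)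
  then have "det ?M = 0"
    using l matrix_left_invertible_ker[of ?M] invertible_left_inverse[of ?M] invertible_det_nz[of ?M] by blast
  then obtain x y z where xyz: "(x, y, z) \<noteq> (0, 0, 0)" "x *s u + y *s v + z *s w = 0"
    by (rule row_combination)
  have solve: "p = (- s / r) *s p'" if "r *s p + s *s p' = 0" "r \<noteq> 0" for r s and p p' :: "'k ^ 3"
    using that by (simp add: vec_eq_iff field_simps eq_neg_iff_add_eq_0)
  have x: "x \<noteq> 0"
  proof
    assume "x = 0"
    with xyz have "y *s v + z *s w = 0" "y \<noteq> 0 \<or> z \<noteq> 0" by auto
    with solve[of y v z w] vw[of "- z / y"] w(1) show False by (cases "y = 0") auto
  qed
  have y: "y \<noteq> 0"
  proof
    assume "y = 0"
    with xyz have "x *s u + z *s w = 0" by simp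
    with solve[of x u z w] uw[of "- z / x"] x show False by auto
  qed
  have "x *s u + y *s v = (- z) *s w"
    using xyz(2) by (simp add: vec_eq_iff eq_neg_iff_add_eq_0)
  then have "quad_form A (x *s u + y *s v) = 0" by (simp only: quad_form_smult w(2) mult_zero_right)
  moreover have "bilin A (x *s u) (y *s v) = x * (y * bilin A u v)"
    by (simp add: vector_scalar_commute scalar_product_smult_left scalar_product_smult_right)
  ultimately have "bilin A u v = 0"
    using x y 2 u(2) v(2) by (simp add: quad_form_add[OF sym] quad_form_smult)
  then show False using isotropic_plane_det_eq_0[OF sym u(2) v(2) _ uv v(1)] det by blast
qed

text \<open>On C the forms D and xC + D coincide. If the latter is, up to a nonzero factor, the
  square of a linear form l, then the intersection of C and D is the part of C on which l vanishes.
  The argument takes place over the algebraic closure, where transversality provides four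
  points.\<close>

lemma not_rank_le_1_pencil:
  fixes C D :: "'a::field ^ 3 ^ 3"
  assumes 2: "(2::'a) \<noteq> 0" and sym: "transpose C = C" and det: "det C \<noteq> 0"
    and trans: "transverse_conics C D"
  shows "\<not> rank_le_1 (pencil C D x)"
proof
  assume "rank_le_1 (pencil C D x)"
  then obtain a l where a: "a \<noteq> 0" and al: "\<And>i j. a * (x * C $ i $ j + D $ i $ j) = l $ i * l $ j"
    unfolding rank_le_1_def pencil_def by auto
  define Ck Dk lk where "Ck = mat_ac C" and "Dk = mat_ac D" and "lk = vec_ac l"
  have 2: "(2::'a alg_closure) \<noteq> 0" using 2 by (metis to_ac_eq_0_iff to_ac_numeral)
  have symk: "transpose Ck = Ck" by (simp add: Ck_def sym flip: mat_ac_transpose)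
  have detk: "det Ck \<noteq> 0" using det by (simp add: Ck_def det_mat_ac)
  have card4: "card (conic Ck \<inter> conic Dk) = 4" using trans by (simp add: transverse_conics_def Ck_def Dk_def)
  have D: "to_ac a * Dk $ i $ j = lk $ i * lk $ j - to_ac a * to_ac x * Ck $ i $ j" for i j
    using arg_cong[OF al[of i j], of to_ac] by (simp add: Dk_def Ck_def lk_def algebra_simps)
  have "to_ac a * quad_form Dk v = (scalar_product lk v)\<^sup>2 - to_ac a * to_ac x * quad_form Ck v" for v
  proof -
    have "to_ac a * quad_form Dk v = (\<Sum>i\<in>UNIV. \<Sum>j\<in>UNIV. (to_ac a * Dk $ i $ j) * (v $ i * v $ j))"
      by (simp add: quad_form_def scalar_product_def matrix_vector_mult_def sum_distrib_left mult_ac)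
    also have "\<dots> = (scalar_product lk v)\<^sup>2 - to_ac a * to_ac x * quad_form Ck v"
      unfolding D by (simp add: quad_form_def scalar_product_def matrix_vector_mult_def sum_3 power2_eq_square algebra_simps)
    finally show ?thesis .
  qed
  then have on_D: "quad_form Dk v = 0 \<longleftrightarrow> scalar_product lk v = 0" if "quad_form Ck v = 0" for v
    using that a by (metis diff_zero mult_eq_0_iff mult_zero_right to_ac_eq_0_iff zero_eq_power2)
  show False
  proof (cases "lk = 0")
    case True
    then have "conic Ck \<subseteq> conic Dk"
      using on_D unfolding conic_def by (auto simp: scalar_product_def)
    \<comment> \<open>The value of \<open>card\<close> at an infinite set is 0, so the cardinality 4
      excludes this case too.\<close>
    then have "infinite (conic Ck \<inter> conic Dk)"
      using infinite_conic[OF 2 symk detk] by (simp add: Int_absorb2)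
    then show False using card4 by simp
  next
    case False
    have "3 \<le> card (conic Ck \<inter> conic Dk)" using card4 by simp
    then obtain T where T: "T \<subseteq> conic Ck \<inter> conic Dk" "card T = 3"
      by (rule obtain_subset_with_card_n)
    then obtain P Q R where "T = {P, Q, R}" "P \<noteq> Q" "Q \<noteq> R" "P \<noteq> R"
      unfolding card_3_iff by blast
    with T have PQR: "P \<noteq> Q" "P \<noteq> R" "Q \<noteq> R" "{P, Q, R} \<subseteq> conic Ck \<inter> conic Dk"
      by simp_all
    have rep: "\<exists>v. v \<noteq> 0 \<and> quad_form Ck v = 0 \<and> scalar_product lk v = 0 \<and> P = proj_point v"
      if P: "P \<in> conic Ck \<inter> conic Dk" for P
    proof -
      obtain v where v: "v \<noteq> 0" "quad_form Ck v = 0" "P = proj_point v"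
        using P unfolding conic_def by blast
      then have "quad_form Dk v = 0" using P by (simp add: proj_point_in_conic)
      with v on_D show ?thesis by blast
    qed
    obtain u where u: "u \<noteq> 0" "quad_form Ck u = 0" "scalar_product lk u = 0" "P = proj_point u"
      using rep[of P] PQR by blast
    obtain v where v: "v \<noteq> 0" "quad_form Ck v = 0" "scalar_product lk v = 0" "Q = proj_point v"
      using rep[of Q] PQR by blast
    obtain w where w: "w \<noteq> 0" "quad_form Ck w = 0" "scalar_product lk w = 0" "R = proj_point w"
      using rep[of R] PQR by blast
    have indep: "p \<noteq> c *s p'" if "p \<noteq> 0" "p' \<noteq> 0" "proj_point p \<noteq> proj_point p'" for c and p p' :: "'a alg_closure ^ 3"
      using that proj_point_eq_iff[of p' p] by auto
    show False
      by (rule line_meets_conic_in_two_points[OF 2 symk detk False u(1-3) v(1-3) w(1-3)])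
        (use PQR u v w indep in metis)+
  qed
qed

section \<open>External and internal points on a conic\<close>

theorem proposition1p2:
  fixes C D :: "'a::{field,finite} ^ 3 ^ 3" and q b1 :: nat and t1 :: int
  assumes q: "q = CARD('a)" "odd q"
    and symmetric: "transpose C = C" "transpose D = D"
    and smooth: "smooth_conic C" "smooth_conic D"
    and transverse: "transverse_conics C D"
    and t1: "t1 = frobenius_trace (pencil_cubic C D)"
    and b1: "b1 = card (conic C \<inter> conic D)"
  shows "real (card {P \<in> conic C - conic D. external_point D P}) =
           1 / 2 * (real q + 1 - real_of_int t1 - real b1) \<and>
         real (card {P \<in> conic C - conic D. internal_point D P}) =
           1 / 2 * (real q + 1 + real_of_int t1 - real b1)"
proof -
  have 2: "(2::'a) \<noteq> 0" using q by (intro two_neq_zero_if_odd_card) simp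
  have det: "det C \<noteq> 0" "det D \<noteq> 0"
    using smooth smooth_conic_iff_det[OF _ 2] symmetric by blast+
  define c where "c = - det D"
  have c: "c \<noteq> 0" using det by (simp add: c_def)
  let ?ext = "{P \<in> conic C - conic D. external_point D P}"
    and ?int = "{P \<in> conic C - conic D. internal_point D P}"
  have ext_iff: "external_point D (proj_point v) \<longleftrightarrow> quad_char (c * quad_form D v) = 1"
    and int_iff: "internal_point D (proj_point v) \<longleftrightarrow> quad_char (c * quad_form D v) = -1"
    if "quad_form D v \<noteq> 0" for v
    using external_internal_point[OF 2 symmetric(2) det(2) that] by (simp_all add: c_def)
  have ext: "?ext = proj_point ` {v. v \<noteq> 0 \<and> quad_form C v = 0 \<and> quad_char (c * quad_form D v) = 1}"
  proof (intro equalityI subsetI)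
    fix P assume P: "P \<in> ?ext"
    then obtain v where v: "v \<noteq> 0" "quad_form C v = 0" "P = proj_point v" by (auto simp: conic_def)
    with P have "quad_form D v \<noteq> 0" by (auto simp: proj_point_in_conic)
    with P v ext_iff show "P \<in> proj_point ` {v. v \<noteq> 0 \<and> quad_form C v = 0 \<and> quad_char (c * quad_form D v) = 1}"
      by blast
  next
    fix P assume "P \<in> proj_point ` {v. v \<noteq> 0 \<and> quad_form C v = 0 \<and> quad_char (c * quad_form D v) = 1}"
    then obtain v where v: "v \<noteq> 0" "quad_form C v = 0" "quad_char (c * quad_form D v) = 1" "P = proj_point v"
      by blast
    then have "quad_form D v \<noteq> 0" by auto
    with v ext_iff show "P \<in> ?ext" by (auto simp: proj_point_in_conic)
  qed
  have "int (card {v. quad_form C v = 0 \<and> quad_form D v = c}) =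
      int q + 1 - int b1 + (\<Sum>x\<in>UNIV. quad_char (det D * det (pencil C D x)))"
    using pencil_count[OF 2 symmetric det not_rank_le_1_pencil[OF 2 symmetric(1) det(1) transverse]
        card_common_zeros[of C D]]
    by (simp add: c_def q(1) b1)
  then have two_ext: "2 * int (card ?ext) = int q + 1 - int b1 - t1"
    unfolding t1 frobenius_trace_pencil_cubic[OF det] card_level_on_conic[OF 2 c] ext by simp
  \<comment> \<open>Off D the character takes only the values 1 and -1, so the rational points of C
    off D split into the two kinds. The internal count then follows from the q + 1 points of C by
    subtraction.\<close>
  have "conic C - conic D = ?ext \<union> ?int"
  proof -
    have "external_point D P \<or> internal_point D P" if P: "P \<in> conic C - conic D" for P
    proof -
      obtain v where v: "v \<noteq> 0" "P = proj_point v" using P by (auto simp: conic_def)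
      with P have Dv: "quad_form D v \<noteq> 0" by (auto simp: proj_point_in_conic)
      show ?thesis
        unfolding v(2) ext_iff[OF Dv] int_iff[OF Dv]
        by (rule quad_char_cases[OF 2, of "c * quad_form D v"]) (use c Dv in auto)
    qed
    then show ?thesis by blast
  qed
  moreover have "?ext \<inter> ?int = {}"
  proof -
    have False if P: "P \<in> conic C - conic D" "external_point D P" "internal_point D P" for P
    proof -
      obtain v where v: "v \<noteq> 0" "P = proj_point v" using P by (auto simp: conic_def)
      with P have Dv: "quad_form D v \<noteq> 0" by (auto simp: proj_point_in_conic)
      show False using P(2,3) unfolding v(2) ext_iff[OF Dv] int_iff[OF Dv] by simp
    qed
    then show ?thesis by blast
  qed
  moreover have fin: "finite (conic C)" unfolding conic_eq_image by (intro finite_imageI) simp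
  ultimately have "card (conic C - conic D) = card ?ext + card ?int"
    by (metis (lifting) card_Un_disjoint finite_Diff finite_Un)
  moreover have "card (conic C) = card (conic C - conic D) + b1"
    unfolding b1 using fin by (subst card_Un_disjoint[symmetric]) (auto intro!: arg_cong[of _ _ card])
  ultimately have "int (card ?ext) + int (card ?int) + int b1 = int q + 1"
    using card_conic[OF 2 symmetric(1) det(1)] q(1) by simp
  with two_ext have "2 * int (card ?int) = int q + 1 + t1 - int b1" by linarith
  then have int: "2 * real (card ?int) = real q + 1 + real_of_int t1 - real b1" by linarith
  have ext: "2 * real (card ?ext) = real q + 1 - real_of_int t1 - real b1" using two_ext by linarith
  have half: "e = 1 / 2 * r" if "2 * e = r" for e r :: real using that by simp
  show ?thesis by (intro conjI half ext int)
qed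

end
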